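(* Let $n>2$. Suppose that $S$ is a uniform $(n\times n)/k$ semi-Latin square, with $\mu:=\mu(S)$. Then $$\eta_0(S)\ge nk^2/2,$$ and the following are equivalent: 1. $\eta_0(S)=nk^2/2$; 2. $\eta(S)=\bigl(nk^2/2,\; n^2k(k-\mu)/2,\;0,\ldots,0,\;nk(\mu-1)/2\bigr)$; 3. $S$ is a $\mu$-fold inflation of a superposition of $n-1$ mutually orthogonal Latin squares (MOLS) of order $n$; 4. $n-1$ MOLS of order $n$ exist and $S$ has minimum PV aberration in the class of uniform $(n\times n)/k$ semi-Latin squares.
   Context: For integers $n>2$ and $k>0$, an $(n\times n)/k$ semi-Latin square is an $n\times n$ array of $k$-subsets (called blocks) of an $nk$-set (of treatments), such that each treatment occurs once in each row and once in each column of the array. An $(n\times n)/1$ semi-Latin square is the same thing as a Latin square of order $n$. A semi-Latin square $S$ is uniform if every pair of blocks, not in the same row or column, intersect in the same positive number $\mu=\mu(S)$ of treatments (in which case $k=\mu(n-1)$). The concurrence of two treatments of a semi-Latin square is the number of blocks (cells) containing both. Define $\eta(S)=(\eta_0(S),\ldots,\eta_n(S))$, where $\eta_i(S)$ is the number of unordered pairs of distinct treatments of $S$ with concurrence equal to $i$. If $S$ is uniform, $\eta(S)$ is called the pairwise-variance (PV) aberration of $S$. For uniform $(n\times n)/k$ semi-Latin squares $S$ and $T$, $S$ has smaller PV aberration than $T$ if $\eta(S)$ is lexicographically less than $\eta(T)$; minimum PV aberration is with respect to this lexicographic order. For $s$ a positive integer, an $s$-fold inflation of an $(n\times n)/k$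 semi-Latin square is the $(n\times n)/(sk)$ semi-Latin square obtained by replacing each treatment $\alpha$ by $s$ treatments $\sigma_{\alpha,1},\ldots,\sigma_{\alpha,s}$, such that $\sigma_{\alpha,i}=\sigma_{\beta,j}$ if and only if $\alpha=\beta$ and $i=j$. The superposition of an $(n\times n)/k$ semi-Latin square with an $(n\times n)/\ell$ semi-Latin square (with disjoint sets of treatments) is the $(n\times n)/(k+\ell)$ semi-Latin square made by superimposing the first upon the second (taking cellwise unions); similarly for more than two squares with pairwise disjoint treatment sets. *)

theory Defs
  imports Complex_Main "HOL-Library.Disjoint_Sets"
begin

text \<open>
  A square of order \<open>n\<close> is a function \<open>S :: nat \<Rightarrow> nat \<Rightarrow> 'a set\<close>, of which only the cells
  \<open>S i j\<close> with \<open>i < n\<close> and \<open>j < n\<close> matter; \<open>V\<close> is its set of treatments.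
\<close>

definition semi_latin_square ::
    "nat \<Rightarrow> nat \<Rightarrow> 'a set \<Rightarrow> (nat \<Rightarrow> nat \<Rightarrow> 'a set) \<Rightarrow> bool" where
  "semi_latin_square n k V S \<longleftrightarrow>
     n > 2 \<and> k > 0 \<and> finite V \<and> card V = n * k \<and>
     (\<forall>i<n. \<forall>j<n. S i j \<subseteq> V \<and> card (S i j) = k) \<and>
     (\<forall>\<alpha>\<in>V. \<forall>i<n. \<exists>!j. j < n \<and> \<alpha> \<in> S i j) \<and>
     (\<forall>\<alpha>\<in>V. \<forall>j<n. \<exists>!i. i < n \<and> \<alpha> \<in> S i j)"

text \<open>
  The last argument is the common intersection size, which is determined by the square
  because \<open>n > 2\<close>.
\<close>

definition uniform_with ::
    "nat \<Rightarrow> nat \<Rightarrow> 'a set \<Rightarrow> (nat \<Rightarrow> nat \<Rightarrow> 'a set) \<Rightarrow> nat \<Rightarrow> bool" where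
  "uniform_with n k V S \<mu> \<longleftrightarrow>
     semi_latin_square n k V S \<and> \<mu> > 0 \<and>
     (\<forall>i<n. \<forall>j<n. \<forall>i'<n. \<forall>j'<n.
        i \<noteq> i' \<longrightarrow> j \<noteq> j' \<longrightarrow> card (S i j \<inter> S i' j') = \<mu>)"

definition uniform ::
    "nat \<Rightarrow> nat \<Rightarrow> 'a set \<Rightarrow> (nat \<Rightarrow> nat \<Rightarrow> 'a set) \<Rightarrow> bool" where
  "uniform n k V S \<longleftrightarrow> (\<exists>\<mu>. uniform_with n k V S \<mu>)"

definition concurrence :: "nat \<Rightarrow> (nat \<Rightarrow> nat \<Rightarrow> 'a set) \<Rightarrow> 'a \<Rightarrow> 'a \<Rightarrow> nat" where
  "concurrence n S \<alpha> \<beta> = card {(i, j). i < n \<and> j < n \<and> \<alpha> \<in> S i j \<and> \<beta> \<in> S i j}"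

definition eta :: "nat \<Rightarrow> 'a set \<Rightarrow> (nat \<Rightarrow> nat \<Rightarrow> 'a set) \<Rightarrow> nat \<Rightarrow> nat" where
  "eta n V S i =
     card {{\<alpha>, \<beta>} | \<alpha> \<beta>. \<alpha> \<in> V \<and> \<beta> \<in> V \<and> \<alpha> \<noteq> \<beta> \<and> concurrence n S \<alpha> \<beta> = i}"

definition eta_vec :: "nat \<Rightarrow> 'a set \<Rightarrow> (nat \<Rightarrow> nat \<Rightarrow> 'a set) \<Rightarrow> nat list" where
  "eta_vec n V S = map (eta n V S) [0..<n + 1]"

definition smaller_PV_aberration ::
    "nat \<Rightarrow> 'a set \<Rightarrow> (nat \<Rightarrow> nat \<Rightarrow> 'a set) \<Rightarrow> 'b set \<Rightarrow> (nat \<Rightarrow> nat \<Rightarrow> 'b set) \<Rightarrow> bool" where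
  "smaller_PV_aberration n V S W T \<longleftrightarrow> (eta_vec n V S, eta_vec n W T) \<in> lexord less_than"

text \<open>
  The competitors \<open>T\<close> have treatments of the same type as \<open>S\<close>. This loses nothing: that type
  contains the \<open>nk\<close>-set \<open>V\<close>, so every \<open>(n \<times> n)/k\<close> semi-Latin square can be relabelled to one
  over it, and relabelling does not change \<^const>\<open>eta_vec\<close>.
\<close>

definition minimum_PV_aberration ::
    "nat \<Rightarrow> nat \<Rightarrow> 'a set \<Rightarrow> (nat \<Rightarrow> nat \<Rightarrow> 'a set) \<Rightarrow> bool" where
  "minimum_PV_aberration n k V S \<longleftrightarrow>
     uniform n k V S \<and>
     (\<forall>(W :: 'a set) T. uniform n k W T \<longrightarrow> \<not> smaller_PV_aberration n W T V S)"

text \<open>Latin squares are identified with semi-Latin squares having singleton blocks.\<close>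

abbreviation latin_square ::
    "nat \<Rightarrow> 'a set \<Rightarrow> (nat \<Rightarrow> nat \<Rightarrow> 'a set) \<Rightarrow> bool" where
  "latin_square n A L \<equiv> semi_latin_square n 1 A L"

definition orthogonal ::
    "nat \<Rightarrow> 'a set \<Rightarrow> (nat \<Rightarrow> nat \<Rightarrow> 'a set) \<Rightarrow> 'b set \<Rightarrow> (nat \<Rightarrow> nat \<Rightarrow> 'b set) \<Rightarrow> bool" where
  "orthogonal n A L B M \<longleftrightarrow>
     (\<forall>x\<in>A. \<forall>y\<in>B. card {(i, j). i < n \<and> j < n \<and> x \<in> L i j \<and> y \<in> M i j} = 1)"

text \<open>
  \<open>L 0, \<dots>, L (m - 1)\<close> are MOLS of order \<open>n\<close>, where \<open>L t\<close> has symbol set \<open>A t\<close>.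
  The symbol sets may overlap.
\<close>

definition MOLS ::
    "nat \<Rightarrow> nat \<Rightarrow> (nat \<Rightarrow> 'a set) \<Rightarrow> (nat \<Rightarrow> nat \<Rightarrow> nat \<Rightarrow> 'a set) \<Rightarrow> bool" where
  "MOLS n m A L \<longleftrightarrow>
     (\<forall>t<m. latin_square n (A t) (L t)) \<and>
     (\<forall>t<m. \<forall>u<m. t \<noteq> u \<longrightarrow> orthogonal n (A t) (L t) (A u) (L u))"

definition superposition ::
    "nat \<Rightarrow> (nat \<Rightarrow> nat \<Rightarrow> nat \<Rightarrow> 'a set) \<Rightarrow> nat \<Rightarrow> nat \<Rightarrow> 'a set" where
  "superposition m L i j = (\<Union>t<m. L t i j)"

definition inflation_of ::
    "nat \<Rightarrow> nat \<Rightarrow> 'b set \<Rightarrow> (nat \<Rightarrow> nat \<Rightarrow> 'b set) \<Rightarrow>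
     'a set \<Rightarrow> (nat \<Rightarrow> nat \<Rightarrow> 'a set) \<Rightarrow> bool" where
  "inflation_of n s W T V S \<longleftrightarrow>
     (\<exists>\<sigma> :: 'b \<Rightarrow> nat \<Rightarrow> 'a.
        (\<forall>\<alpha>\<in>W. \<forall>\<beta>\<in>W. \<forall>p\<in>{1..s}. \<forall>q\<in>{1..s}. \<sigma> \<alpha> p = \<sigma> \<beta> q \<longleftrightarrow> \<alpha> = \<beta> \<and> p = q) \<and>
        V = {\<sigma> \<alpha> p | \<alpha> p. \<alpha> \<in> W \<and> p \<in> {1..s}} \<and>
        (\<forall>i<n. \<forall>j<n. S i j = {\<sigma> \<alpha> p | \<alpha> p. \<alpha> \<in> T i j \<and> p \<in> {1..s}}))"

text \<open>
  In the next two definitions natural numbers serve as symbols. This is no restriction, since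
  every finite set of symbols can be relabelled by natural numbers.
\<close>

definition MOLS_exist :: "nat \<Rightarrow> nat \<Rightarrow> bool" where
  "MOLS_exist n m \<longleftrightarrow>
     (\<exists>(A :: nat \<Rightarrow> nat set) (L :: nat \<Rightarrow> nat \<Rightarrow> nat \<Rightarrow> nat set). MOLS n m A L)"

definition inflation_of_MOLS_superposition ::
    "nat \<Rightarrow> nat \<Rightarrow> nat \<Rightarrow> 'a set \<Rightarrow> (nat \<Rightarrow> nat \<Rightarrow> 'a set) \<Rightarrow> bool" where
  "inflation_of_MOLS_superposition n s m V S \<longleftrightarrow>
     (\<exists>(A :: nat \<Rightarrow> nat set) (L :: nat \<Rightarrow> nat \<Rightarrow> nat \<Rightarrow> nat set).
        MOLS n m A L \<and> disjoint_family_on A {..<m} \<and>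
        inflation_of n s (\<Union>t<m. A t) (superposition m L) V S)"

end

theory Submission
  imports Defs "HOL-Library.Nat_Bijection"
begin

text \<open>
  Write \<open>c\<close> for the concurrence with a fixed treatment \<open>\<alpha>\<close>. Uniformity determines the first two
  moments of \<open>c\<close>, hence \<open>\<Sum>(c - 1)(c - n) = nk\<close>, and as only the zeros of \<open>c\<close> contribute
  positively, at least \<open>k\<close> treatments never concur with \<open>\<alpha>\<close>. Equality holds iff all
  concurrences lie in \<open>{0, 1, n}\<close>. In that case every block contains exactly \<open>\<mu>\<close> treatments with
  \<open>c \<noteq> 1\<close>, which makes "not concurring exactly once" an equivalence relation; its \<open>n - 1\<close>
  classes are \<open>\<mu>\<close>-fold inflations of mutually orthogonal Latin squares.
\<close>

text \<open>The value \<open>n * k\<close> of the sum is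
  \<open>2 * n * k - (n + 1) * (n * k) + n * (n * k)\<close>: per treatment the squared concurrences
  add up to \<open>2 * n * k\<close> and the concurrences to \<open>n * k\<close>, over
  \<open>n * k\<close> treatments. The sums include \<alpha> itself, whose concurrence
  \<open>n\<close> is a root of the quadratic. The obstacle to recovering Latin squares is
  transitivity, because nothing visible relates two treatments that both avoid \<alpha>. It is
  settled inside a single block, where the treatments not concurring once with \<alpha> turn out to
  be copies of one symbol. Minimum aberration yields the equality only if some square attains the
  bound, which is why the last condition asks for MOLS. Conversely, the extremal vector depends on
  \<open>n\<close> and \<open>k\<close> alone, so the order cannot separate two extremal
  squares.\<close>

section \<open>Double counting of treatments, cells and pairs\<close>

definition cells :: "nat \<Rightarrow> (nat \<Rightarrow> nat \<Rightarrow> 'a set) \<Rightarrow> 'a \<Rightarrow> (nat \<times> nat) set" where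
  "cells n S \<alpha> = {(i, j). i < n \<and> j < n \<and> \<alpha> \<in> S i j}"

lemma finite_cells [simp]: "finite (cells n S \<alpha>)"
  by (rule finite_subset[of _ "{..<n} \<times> {..<n}"]) (auto simp: cells_def)

lemma concurrence_eq_card_Int: "concurrence n S \<alpha> \<beta> = card (cells n S \<alpha> \<inter> cells n S \<beta>)"
  unfolding concurrence_def by (rule arg_cong[of _ _ card]) (auto simp: cells_def)

lemma concurrence_sym: "concurrence n S \<alpha> \<beta> = concurrence n S \<beta> \<alpha>"
  by (simp add: concurrence_eq_card_Int Int_commute)

text \<open>Double counting of the incidences between treatments and cells of \<open>C\<close>,
  weighted by \<open>f\<close>. Weights are there for the second moment, where \<open>f\<close> is
  the concurrence itself; \<open>C\<close> is left free so that the blocks outside one row and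
  column can be counted in the same way.\<close>

lemma sum_times_card_cells:
  fixes f :: "'a \<Rightarrow> nat"
  assumes "finite B" and C: "C \<subseteq> {..<n} \<times> {..<n}"
  shows "(\<Sum>\<beta>\<in>B. f \<beta> * card (C \<inter> cells n S \<beta>)) = (\<Sum>(i, j)\<in>C. sum f (B \<inter> S i j))"
proof -
  have "finite C" using C by (rule finite_subset) simp
  have "(\<Sum>\<beta>\<in>B. f \<beta> * card (C \<inter> cells n S \<beta>))
    = (\<Sum>\<beta>\<in>B. \<Sum>(i, j)\<in>C. if \<beta> \<in> S i j then f \<beta> else 0)"
  proof (rule sum.cong[OF refl])
    fix \<beta>
    have "C \<inter> cells n S \<beta> = C \<inter> {(i, j). \<beta> \<in> S i j}"
      using C by (auto simp: cells_def)
    then show "f \<beta> * card (C \<inter> cells n S \<beta>) = (\<Sum>(i, j)\<in>C. if \<beta> \<in> S i j then f \<beta> else 0)"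
      using \<open>finite C\<close> by (simp add: split_def sum.If_cases mult.commute)
  qed
  also have "\<dots> = (\<Sum>(i, j)\<in>C. \<Sum>\<beta>\<in>B. if \<beta> \<in> S i j then f \<beta> else 0)"
    by (simp add: split_def) (rule sum.swap)
  also have "\<dots> = (\<Sum>(i, j)\<in>C. sum f (B \<inter> S i j))"
    using assms(1) by (simp add: sum.If_cases)
  finally show ?thesis .
qed

lemma cells_subset: "cells n S \<alpha> \<subseteq> {..<n} \<times> {..<n}"
  by (auto simp: cells_def)

lemma sum_times_concurrence:
  fixes f :: "'a \<Rightarrow> nat"
  assumes "finite B"
  shows "(\<Sum>\<beta>\<in>B. f \<beta> * concurrence n S \<alpha> \<beta>)
    = (\<Sum>x\<in>cells n S \<alpha>. sum f (B \<inter> S (fst x) (snd x)))"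
  using sum_times_card_cells[OF assms cells_subset]
  by (simp add: concurrence_eq_card_Int split_def)

lemma sum_concurrence:
  assumes "finite B"
  shows "(\<Sum>\<beta>\<in>B. concurrence n S \<alpha> \<beta>)
    = (\<Sum>x\<in>cells n S \<alpha>. card (B \<inter> S (fst x) (snd x)))"
  using sum_times_concurrence[OF assms, of "\<lambda>_. 1"] by simp

text \<open>The map from \<open>(x, y)\<close> to \<open>{x, y}\<close> has fibres of size exactly
  two, as \<open>x\<close> and \<open>y\<close> differ and \<open>R\<close> is symmetric.\<close>

lemma card_symmetric_pairs:
  assumes "finite V" and sym: "\<And>x y. R x y \<Longrightarrow> R y x"
  shows "2 * card {{x, y} | x y. x \<in> V \<and> y \<in> V \<and> x \<noteq> y \<and> R x y}
    = (\<Sum>x\<in>V. card {y \<in> V. x \<noteq> y \<and> R x y})"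
proof -
  define P where "P = (SIGMA x:V. {y \<in> V. x \<noteq> y \<and> R x y})"
  let ?g = "\<lambda>(x, y). {x, y}"
  have fin: "finite P" unfolding P_def using assms(1) by auto
  have img: "?g ` P = {{x, y} | x y. x \<in> V \<and> y \<in> V \<and> x \<noteq> y \<and> R x y}"
    by (auto simp: P_def image_def)
  have fibre: "card {q \<in> P. ?g q = e} = 2" if "e \<in> ?g ` P" for e
  proof -
    from that obtain x y where xy: "(x, y) \<in> P" "e = {x, y}" by auto
    have "{q \<in> P. ?g q = e} = {(x, y), (y, x)}"
      using xy sym by (auto simp: P_def doubleton_eq_iff)
    moreover have "x \<noteq> y" using xy by (auto simp: P_def)
    ultimately show ?thesis by simp
  qed
  have "card P = (\<Sum>e\<in>?g ` P. card {q \<in> P. ?g q = e})"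
    using sum.image_gen[OF fin, of "\<lambda>_. 1::nat" ?g] by simp
  also have "\<dots> = 2 * card (?g ` P)" using fibre by simp
  finally show ?thesis
    unfolding img using assms(1) by (simp add: P_def)
qed

lemma two_eta:
  assumes "finite V"
  shows "2 * eta n V S i = (\<Sum>\<alpha>\<in>V. card {\<beta> \<in> V. \<alpha> \<noteq> \<beta> \<and> concurrence n S \<alpha> \<beta> = i})"
  unfolding eta_def
  by (rule card_symmetric_pairs[OF assms]) (simp add: concurrence_sym)

section \<open>Elementary properties of semi-Latin squares\<close>

locale semi_latin =
  fixes n k :: nat and V :: "'a set" and S :: "nat \<Rightarrow> nat \<Rightarrow> 'a set"
  assumes semi_latin: "semi_latin_square n k V S"
begin

lemma n_gt_2: "n > 2" and k_pos: "k > 0" and finite_V [simp]: "finite V" and card_V: "card V = n * k"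
  using semi_latin by (auto simp: semi_latin_square_def)

lemma block_subset: "i < n \<Longrightarrow> j < n \<Longrightarrow> S i j \<subseteq> V"
  and card_block: "i < n \<Longrightarrow> j < n \<Longrightarrow> card (S i j) = k"
  and ex1_col: "\<alpha> \<in> V \<Longrightarrow> i < n \<Longrightarrow> \<exists>!j. j < n \<and> \<alpha> \<in> S i j"
  and ex1_row: "\<alpha> \<in> V \<Longrightarrow> j < n \<Longrightarrow> \<exists>!i. i < n \<and> \<alpha> \<in> S i j"
  using semi_latin by (auto simp: semi_latin_square_def)

lemma finite_block: "i < n \<Longrightarrow> j < n \<Longrightarrow> finite (S i j)"
  using block_subset finite_V finite_subset by blast

lemma row_unique: "i < n \<Longrightarrow> j < n \<Longrightarrow> j' < n \<Longrightarrow> \<alpha> \<in> S i j \<Longrightarrow> \<alpha> \<in> S i j' \<Longrightarrow> j = j'"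
  using ex1_col[of \<alpha> i] block_subset[of i j] by blast

lemma col_unique: "i < n \<Longrightarrow> i' < n \<Longrightarrow> j < n \<Longrightarrow> \<alpha> \<in> S i j \<Longrightarrow> \<alpha> \<in> S i' j \<Longrightarrow> i = i'"
  using ex1_row[of \<alpha> j] block_subset[of i j] by blast

lemma row_disjoint: "i < n \<Longrightarrow> j < n \<Longrightarrow> j' < n \<Longrightarrow> j \<noteq> j' \<Longrightarrow> S i j \<inter> S i j' = {}"
  using row_unique by blast

lemma col_disjoint: "i < n \<Longrightarrow> i' < n \<Longrightarrow> j < n \<Longrightarrow> i \<noteq> i' \<Longrightarrow> S i j \<inter> S i' j = {}"
  using col_unique by blast

lemma cells_apart:
  "(i, j) \<in> cells n S \<alpha> \<Longrightarrow> (i', j') \<in> cells n S \<alpha> \<Longrightarrow> (i, j) \<noteq> (i', j') \<Longrightarrow> i \<noteq> i' \<and> j \<noteq> j'"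
  using row_unique col_unique by (auto simp: cells_def)

lemma card_cells:
  assumes "\<alpha> \<in> V"
  shows "card (cells n S \<alpha>) = n"
proof -
  have "inj_on fst (cells n S \<alpha>)"
    using cells_apart by (fastforce simp: inj_on_def)
  moreover have "fst ` cells n S \<alpha> = {..<n}"
    using ex1_col[OF assms] by (force simp: cells_def image_iff)
  ultimately show ?thesis by (metis card_image card_lessThan)
qed

lemma concurrence_self: "\<alpha> \<in> V \<Longrightarrow> concurrence n S \<alpha> \<alpha> = n"
  by (simp add: concurrence_eq_card_Int card_cells)

lemma concurrence_le: "\<alpha> \<in> V \<Longrightarrow> concurrence n S \<alpha> \<beta> \<le> n"
  using card_mono[of "cells n S \<alpha>" "cells n S \<alpha> \<inter> cells n S \<beta>"]
  by (simp add: concurrence_eq_card_Int card_cells)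

text \<open>Both cell sets have \<open>n\<close> elements, so an intersection of size
  \<open>n\<close> exhausts each of them. Such treatments are the twins spoken of below.\<close>

lemma concurrence_eq_n_iff:
  assumes "\<alpha> \<in> V" "\<beta> \<in> V"
  shows "concurrence n S \<alpha> \<beta> = n \<longleftrightarrow> cells n S \<alpha> = cells n S \<beta>"
proof
  assume "concurrence n S \<alpha> \<beta> = n"
  then have c: "card (cells n S \<alpha> \<inter> cells n S \<beta>) = n"
    by (simp add: concurrence_eq_card_Int)
  have "cells n S \<alpha> \<inter> cells n S \<beta> = cells n S \<alpha>"
    by (rule card_subset_eq) (use c assms card_cells in auto)
  moreover have "cells n S \<alpha> \<inter> cells n S \<beta> = cells n S \<beta>"
    by (rule card_subset_eq) (use c assms card_cells in auto)
  ultimately show "cells n S \<alpha> = cells n S \<beta>" by simp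
next
  assume "cells n S \<alpha> = cells n S \<beta>"
  then show "concurrence n S \<alpha> \<beta> = n" using assms by (simp add: concurrence_eq_card_Int card_cells)
qed

lemma V_Int_block: "x \<in> cells n S \<alpha> \<Longrightarrow> V \<inter> S (fst x) (snd x) = S (fst x) (snd x)"
  using block_subset[of "fst x" "snd x"] by (auto simp: cells_def)

lemma sum_concurrence_V:
  assumes "\<alpha> \<in> V"
  shows "(\<Sum>\<beta>\<in>V. concurrence n S \<alpha> \<beta>) = n * k"
proof -
  have "card (V \<inter> S (fst x) (snd x)) = k" if "x \<in> cells n S \<alpha>" for x
    using that card_block by (auto simp: V_Int_block cells_def)
  then show ?thesis by (simp add: sum_concurrence card_cells assms)
qed

end

section \<open>Moments of the concurrence in a uniform square\<close>

locale uniform_square =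
  fixes n k :: nat and V :: "'a set" and S :: "nat \<Rightarrow> nat \<Rightarrow> 'a set" and \<mu> :: nat
  assumes uniform: "uniform_with n k V S \<mu>"

sublocale uniform_square \<subseteq> semi_latin
  using uniform by unfold_locales (simp add: uniform_with_def)

context uniform_square
begin

lemma mu_pos: "\<mu> > 0"
  using uniform by (simp add: uniform_with_def)

lemma card_block_Int:
  "i < n \<Longrightarrow> j < n \<Longrightarrow> i' < n \<Longrightarrow> j' < n \<Longrightarrow> i \<noteq> i' \<Longrightarrow> j \<noteq> j' \<Longrightarrow> card (S i j \<inter> S i' j') = \<mu>"
  using uniform by (simp add: uniform_with_def)

text \<open>A treatment of the block at \<open>(0, 0)\<close> lies in exactly one block of row 1,
  and not in the one of column 0. The other \<open>n - 1\<close> blocks of that row cut the block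
  into pieces of size \<mu>.\<close>

lemma k_eq: "k = (n - 1) * \<mu>"
proof -
  have n: "0 < n" "1 < n" using n_gt_2 by auto
  have "S 0 0 = (\<Union>j\<in>{1..<n}. S 0 0 \<inter> S 1 j)"
  proof -
    have "\<exists>j\<in>{1..<n}. \<alpha> \<in> S 1 j" if \<alpha>: "\<alpha> \<in> S 0 0" for \<alpha>
    proof -
      obtain j where j: "j < n" "\<alpha> \<in> S 1 j"
        using ex1_implies_ex[OF ex1_col[of \<alpha> 1]] \<alpha> subsetD[OF block_subset[of 0 0]] n by auto
      then have "j \<noteq> 0" using \<alpha> col_disjoint[of 0 1 0] n by auto
      then show ?thesis using j by auto
    qed
    then show ?thesis by blast
  qed
  then have "card (S 0 0) = card (\<Union>j\<in>{1..<n}. S 0 0 \<inter> S 1 j)" by simp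
  also have "\<dots> = (\<Sum>j\<in>{1..<n}. card (S 0 0 \<inter> S 1 j))"
  proof (rule card_UN_disjoint)
    show "\<forall>i\<in>{1..<n}. \<forall>j\<in>{1..<n}. i \<noteq> j \<longrightarrow> (S 0 0 \<inter> S 1 i) \<inter> (S 0 0 \<inter> S 1 j) = {}"
      using row_disjoint[of 1] n by fastforce
  qed (use finite_block n in auto)
  also have "\<dots> = (\<Sum>j\<in>{1..<n}. \<mu>)"
    using n by (intro sum.cong refl card_block_Int) auto
  finally show ?thesis using card_block n by simp
qed

text \<open>The cell \<open>(i, j)\<close> itself contributes \<open>k\<close>; the other
  \<open>n - 1\<close> cells of \<alpha> avoid its row and column and together contribute
  \<open>(n - 1) * \<mu> = k\<close>.\<close>

lemma sum_concurrence_block_mem: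
  assumes "(i, j) \<in> cells n S \<alpha>"
  shows "(\<Sum>\<beta>\<in>S i j. concurrence n S \<alpha> \<beta>) = 2 * k"
proof -
  have ij: "i < n" "j < n" "\<alpha> \<in> S i j" using assms by (auto simp: cells_def)
  then have V: "\<alpha> \<in> V" using block_subset by blast
  have "(\<Sum>\<beta>\<in>S i j. concurrence n S \<alpha> \<beta>)
    = card (S i j \<inter> S i j) + (\<Sum>x\<in>cells n S \<alpha> - {(i, j)}. card (S i j \<inter> S (fst x) (snd x)))"
    using assms ij by (simp add: sum_concurrence finite_block sum.remove[of _ "(i, j)"])
  also have "(\<Sum>x\<in>cells n S \<alpha> - {(i, j)}. card (S i j \<inter> S (fst x) (snd x)))
    = (\<Sum>x\<in>cells n S \<alpha> - {(i, j)}. \<mu>)"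
  proof (rule sum.cong[OF refl])
    fix x assume x: "x \<in> cells n S \<alpha> - {(i, j)}"
    obtain i' j' where x': "x = (i', j')" by fastforce
    then have "i \<noteq> i' \<and> j \<noteq> j'" using x cells_apart[OF assms, of i' j'] by auto
    then show "card (S i j \<inter> S (fst x) (snd x)) = \<mu>"
      using x x' ij by (auto simp: cells_def intro!: card_block_Int)
  qed
  finally show ?thesis
    using assms ij V by (simp add: card_cells card_block k_eq)
qed

text \<open>Exactly two cells of \<alpha> share a row or column with \<open>(i, j)\<close>, and
  their blocks are disjoint from \<open>S i j\<close>. Each of the remaining \<open>n - 2\<close>
  contributes \<mu>.\<close>

lemma sum_concurrence_block_not_mem:
  assumes ij: "i < n" "j < n" and "\<alpha> \<in> V" "\<alpha> \<notin> S i j"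
  shows "(\<Sum>\<beta>\<in>S i j. concurrence n S \<alpha> \<beta>) = (n - 2) * \<mu>"
proof -
  obtain j' where j': "j' < n" "\<alpha> \<in> S i j'" using ex1_col ij assms by blast
  obtain i' where i': "i' < n" "\<alpha> \<in> S i' j" using ex1_row ij assms by blast
  have ne: "i' \<noteq> i" "j' \<noteq> j" using assms i' j' by auto
  let ?R = "{(i, j'), (i', j)}"
  have R: "?R \<subseteq> cells n S \<alpha>" using i' j' ij by (auto simp: cells_def)
  have card_R: "card ?R = 2" using ne by auto
  have "(\<Sum>\<beta>\<in>S i j. concurrence n S \<alpha> \<beta>)
    = (\<Sum>x\<in>cells n S \<alpha>. card (S i j \<inter> S (fst x) (snd x)))"
    using ij by (simp add: sum_concurrence finite_block)
  also have "\<dots> = (\<Sum>x\<in>cells n S \<alpha> - ?R. card (S i j \<inter> S (fst x) (snd x)))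
      + (\<Sum>x\<in>?R. card (S i j \<inter> S (fst x) (snd x)))"
    by (rule sum.subset_diff[OF R]) simp
  also have "(\<Sum>x\<in>?R. card (S i j \<inter> S (fst x) (snd x))) = 0"
    using ne ij i' j' row_disjoint[of i j j'] col_disjoint[of i i' j] by auto
  also have "(\<Sum>x\<in>cells n S \<alpha> - ?R. card (S i j \<inter> S (fst x) (snd x)))
    = (\<Sum>x\<in>cells n S \<alpha> - ?R. \<mu>)"
  proof (rule sum.cong[OF refl])
    fix x assume x: "x \<in> cells n S \<alpha> - ?R"
    obtain a b where x': "x = (a, b)" by fastforce
    have "(a, b) \<in> cells n S \<alpha>" using x x' by auto
    moreover have "a \<noteq> i" "b \<noteq> j"
      using x x' R cells_apart[of a b \<alpha> i j'] cells_apart[of a b \<alpha> i' j] by auto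
    ultimately show "card (S i j \<inter> S (fst x) (snd x)) = \<mu>"
      using x' ij by (auto simp: cells_def intro!: card_block_Int)
  qed
  also have "\<dots> = (n - 2) * \<mu>"
    using R card_R assms by (simp add: card_Diff_subset card_cells)
  finally show ?thesis by simp
qed

text \<open>One factor of the square is the weight in the double count, so each of the
  \<open>n\<close> blocks through \<alpha> contributes \<open>2 * k\<close>.\<close>

lemma sum_concurrence_sq:
  assumes "\<alpha> \<in> V"
  shows "(\<Sum>\<beta>\<in>V. concurrence n S \<alpha> \<beta> * concurrence n S \<alpha> \<beta>) = 2 * n * k"
proof -
  have "sum (concurrence n S \<alpha>) (V \<inter> S (fst x) (snd x)) = 2 * k" if "x \<in> cells n S \<alpha>" for x
    using that sum_concurrence_block_mem[of "fst x" "snd x" \<alpha>] by (simp add: V_Int_block)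
  then show ?thesis using assms by (simp add: sum_times_concurrence card_cells)
qed

text \<open>
  The quadratic \<open>(c - 1)(c - n)\<close> is positive at \<open>c = 0\<close> and nonpositive at \<open>c = 1, \<dots>, n\<close>,
  and its sum over the concurrences with a fixed treatment does not depend on the square.
\<close>

lemma card_concurrence_0:
  assumes "\<alpha> \<in> V"
  shows "n * card {\<beta> \<in> V. concurrence n S \<alpha> \<beta> = 0}
    = n * k + (\<Sum>\<beta>\<in>V. (concurrence n S \<alpha> \<beta> - 1) * (n - concurrence n S \<alpha> \<beta>))"
proof -
  let ?c = "\<lambda>\<beta>. int (concurrence n S \<alpha> \<beta>)"
  let ?g = "\<lambda>\<beta>. (concurrence n S \<alpha> \<beta> - 1) * (n - concurrence n S \<alpha> \<beta>)"
  \<comment> \<open>At concurrence 0 the truncated factor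
    \<open>concurrence n S \<alpha> \<beta> - 1\<close> makes \<open>?g\<close> vanish, and the
    indicator supplies the value \<open>n\<close>. Elsewhere \<open>?g\<close> is the negated
    quadratic.\<close>
  have pt: "(?c \<beta> * ?c \<beta> - (int n + 1) * ?c \<beta> + int n)
    = int n * of_bool (concurrence n S \<alpha> \<beta> = 0) - int (?g \<beta>)" for \<beta>
  proof (cases "concurrence n S \<alpha> \<beta> = 0")
    case False
    obtain d where d: "concurrence n S \<alpha> \<beta> = Suc d"
      using not0_implies_Suc[OF False] by auto
    obtain e where e: "n = Suc d + e"
      using le_Suc_ex[OF concurrence_le[OF assms, of \<beta>]] d by auto
    have "n - Suc d = e" using e by simp
    then have "?g \<beta> = d * e" using d by simp
    then show ?thesis using d by (simp add: e algebra_simps)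
  qed simp
  have "int n * int k = 2 * int n * int k - (int n + 1) * (int n * int k) + int n * (int n * int k)"
    by (simp add: algebra_simps)
  also have "\<dots> = (\<Sum>\<beta>\<in>V. ?c \<beta> * ?c \<beta>) - (int n + 1) * (\<Sum>\<beta>\<in>V. ?c \<beta>) + (\<Sum>\<beta>\<in>V. int n)"
    using arg_cong[OF sum_concurrence_sq[OF assms], of int]
      arg_cong[OF sum_concurrence_V[OF assms], of int] by (simp add: card_V)
  also have "\<dots> = (\<Sum>\<beta>\<in>V. ?c \<beta> * ?c \<beta> - (int n + 1) * ?c \<beta> + int n)"
    by (simp add: sum.distrib sum_subtractf sum_distrib_left)
  also have "\<dots> = int n * (\<Sum>\<beta>\<in>V. of_bool (concurrence n S \<alpha> \<beta> = 0)) - int (\<Sum>\<beta>\<in>V. ?g \<beta>)"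
    unfolding pt by (simp add: sum_subtractf sum_distrib_left)
  also have "(\<Sum>\<beta>\<in>V. of_bool (concurrence n S \<alpha> \<beta> = 0)) = int (card {\<beta> \<in> V. concurrence n S \<alpha> \<beta> = 0})"
    by (simp add: Int_def)
  finally have "int (n * card {\<beta> \<in> V. concurrence n S \<alpha> \<beta> = 0}) = int (n * k + (\<Sum>\<beta>\<in>V. ?g \<beta>))"
    by simp
  then show ?thesis by (simp only: of_nat_eq_iff)
qed

lemma card_concurrence_0_ge:
  assumes "\<alpha> \<in> V"
  shows "card {\<beta> \<in> V. concurrence n S \<alpha> \<beta> = 0} \<ge> k"
proof -
  have "n * k \<le> n * card {\<beta> \<in> V. concurrence n S \<alpha> \<beta> = 0}"
    unfolding card_concurrence_0[OF assms] by simp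
  then show ?thesis using n_gt_2 by simp
qed

text \<open>The correction term is a sum of natural numbers, so equality makes every summand vanish:
  the concurrence is at most 1 or equal to \<open>n\<close>. Truncated subtraction is what admits
  0.\<close>

lemma card_concurrence_0_eq_iff:
  assumes "\<alpha> \<in> V"
  shows "card {\<beta> \<in> V. concurrence n S \<alpha> \<beta> = 0} = k
    \<longleftrightarrow> (\<forall>\<beta>\<in>V. concurrence n S \<alpha> \<beta> \<in> {0, 1, n})"
proof -
  have "card {\<beta> \<in> V. concurrence n S \<alpha> \<beta> = 0} = k
    \<longleftrightarrow> n * card {\<beta> \<in> V. concurrence n S \<alpha> \<beta> = 0} = n * k"
    using n_gt_2 by simp
  also have "\<dots> \<longleftrightarrow> (\<forall>\<beta>\<in>V. (concurrence n S \<alpha> \<beta> - 1) * (n - concurrence n S \<alpha> \<beta>) = 0)"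
    unfolding card_concurrence_0[OF assms] by simp
  also have "\<dots> \<longleftrightarrow> (\<forall>\<beta>\<in>V. concurrence n S \<alpha> \<beta> \<in> {0, 1, n})"
    using concurrence_le[OF assms] by (intro ball_cong refl) (simp add: le_Suc_eq, metis diff_is_0_eq order_antisym order_refl)
  finally show ?thesis .
qed

section \<open>The lower bound for the first entry and its equality case\<close>

lemma two_eta_0: "2 * eta n V S 0 = (\<Sum>\<alpha>\<in>V. card {\<beta> \<in> V. concurrence n S \<alpha> \<beta> = 0})"
proof -
  have "{\<beta> \<in> V. \<alpha> \<noteq> \<beta> \<and> concurrence n S \<alpha> \<beta> = 0} = {\<beta> \<in> V. concurrence n S \<alpha> \<beta> = 0}"
    if "\<alpha> \<in> V" for \<alpha>
    using that concurrence_self n_gt_2 by auto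
  then show ?thesis by (simp add: two_eta)
qed

lemma two_eta_0_ge: "2 * eta n V S 0 \<ge> n * k\<^sup>2"
proof -
  have "(\<Sum>\<alpha>\<in>V. k) \<le> (\<Sum>\<alpha>\<in>V. card {\<beta> \<in> V. concurrence n S \<alpha> \<beta> = 0})"
    by (rule sum_mono) (rule card_concurrence_0_ge)
  then show ?thesis by (simp add: two_eta_0 card_V power2_eq_square mult.assoc)
qed

text \<open>The bound adds up one inequality per treatment, so it is tight only if each of these
  is.\<close>

lemma two_eta_0_eq_iff:
  "2 * eta n V S 0 = n * k\<^sup>2 \<longleftrightarrow> (\<forall>\<alpha>\<in>V. \<forall>\<beta>\<in>V. concurrence n S \<alpha> \<beta> \<in> {0, 1, n})"
proof -
  have "2 * eta n V S 0 = n * k\<^sup>2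
    \<longleftrightarrow> (\<Sum>\<alpha>\<in>V. k) = (\<Sum>\<alpha>\<in>V. card {\<beta> \<in> V. concurrence n S \<alpha> \<beta> = 0})"
    by (auto simp: two_eta_0 card_V power2_eq_square)
  also have "\<dots> \<longleftrightarrow> (\<forall>\<alpha>\<in>V. card {\<beta> \<in> V. concurrence n S \<alpha> \<beta> = 0} = k)"
  proof
    assume "(\<Sum>\<alpha>\<in>V. k) = (\<Sum>\<alpha>\<in>V. card {\<beta> \<in> V. concurrence n S \<alpha> \<beta> = 0})"
    then have "k = card {\<beta> \<in> V. concurrence n S \<alpha> \<beta> = 0}" if "\<alpha> \<in> V" for \<alpha>
      by (rule sum_mono_inv) (use that card_concurrence_0_ge in auto)
    then show "\<forall>\<alpha>\<in>V. card {\<beta> \<in> V. concurrence n S \<alpha> \<beta> = 0} = k" by simp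
  qed simp
  finally show ?thesis using card_concurrence_0_eq_iff by simp
qed

end

section \<open>The concurrence distribution of an extremal square\<close>

locale extremal_square = uniform_square +
  assumes concurrence_cases: "\<alpha> \<in> V \<Longrightarrow> \<beta> \<in> V \<Longrightarrow> concurrence n S \<alpha> \<beta> \<in> {0, 1, n}"
begin

text \<open>Among the values 0, 1 and \<open>n\<close>, only \<open>n\<close> differs from its
  square, by \<open>n * (n - 1)\<close>. The two moments differ by
  \<open>n * k = n * (n - 1) * \<mu>\<close>, which fixes the count; it includes \<alpha>
  itself.\<close>

lemma card_concurrence_n:
  assumes "\<alpha> \<in> V"
  shows "card {\<beta> \<in> V. concurrence n S \<alpha> \<beta> = n} = \<mu>"
proof -
  let ?N = "{\<beta> \<in> V. concurrence n S \<alpha> \<beta> = n}"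
  have pt: "concurrence n S \<alpha> \<beta> * concurrence n S \<alpha> \<beta>
    = concurrence n S \<alpha> \<beta> + (if concurrence n S \<alpha> \<beta> = n then n * (n - 1) else 0)"
    if "\<beta> \<in> V" for \<beta>
    using concurrence_cases[OF assms that] n_gt_2 by (auto simp: algebra_simps diff_mult_distrib2)
  have "2 * n * k = (\<Sum>\<beta>\<in>V. concurrence n S \<alpha> \<beta>
    + (if concurrence n S \<alpha> \<beta> = n then n * (n - 1) else 0))"
    unfolding sum_concurrence_sq[OF assms, symmetric] using pt by (rule sum.cong[OF refl])
  also have "\<dots> = n * k + n * (n - 1) * card ?N"
    by (simp add: sum.distrib sum_concurrence_V assms sum.If_cases Int_def)
  finally have "n * k = n * (n - 1) * card ?N" by simp
  then have "n * (n - 1) * card ?N = n * (n - 1) * \<mu>" by (simp only: k_eq mult.assoc)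
  then show ?thesis using n_gt_2 by auto
qed

text \<open>The twins use up \<open>n * \<mu>\<close> of the total concurrence \<open>n * k\<close>;
  the rest consists of ones.\<close>

lemma card_concurrence_1:
  assumes "\<alpha> \<in> V"
  shows "card {\<beta> \<in> V. concurrence n S \<alpha> \<beta> = 1} = n * (k - \<mu>)"
proof -
  have pt: "concurrence n S \<alpha> \<beta> = (if concurrence n S \<alpha> \<beta> = 1 then 1 else 0)
      + (if concurrence n S \<alpha> \<beta> = n then n else 0)" if "\<beta> \<in> V" for \<beta>
    using concurrence_cases[OF assms that] n_gt_2 by auto
  have "n * k = (\<Sum>\<beta>\<in>V. (if concurrence n S \<alpha> \<beta> = 1 then 1 else 0)
      + (if concurrence n S \<alpha> \<beta> = n then n else 0))"
    unfolding sum_concurrence_V[OF assms, symmetric] using pt by (rule sum.cong[OF refl])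
  also have "\<dots> = card {\<beta> \<in> V. concurrence n S \<alpha> \<beta> = 1} + n * \<mu>"
    using card_concurrence_n[OF assms]
    by (simp add: sum.distrib sum.If_cases Int_def mult.commute)
  finally show ?thesis by (simp add: diff_mult_distrib2)
qed

lemma two_eta_1: "2 * eta n V S 1 = n * k * (n * (k - \<mu>))"
proof -
  have "{\<beta> \<in> V. \<alpha> \<noteq> \<beta> \<and> concurrence n S \<alpha> \<beta> = 1} = {\<beta> \<in> V. concurrence n S \<alpha> \<beta> = 1}"
    if "\<alpha> \<in> V" for \<alpha>
    using that concurrence_self n_gt_2 by auto
  then show ?thesis using card_concurrence_1 by (simp add: two_eta card_V)
qed

lemma two_eta_n: "2 * eta n V S n = n * k * (\<mu> - 1)"
proof -
  have "card {\<beta> \<in> V. \<alpha> \<noteq> \<beta> \<and> concurrence n S \<alpha> \<beta> = n} = \<mu> - 1" if "\<alpha> \<in> V" for \<alpha>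
  proof -
    \<comment> \<open>Pairs consist of distinct treatments, so \<alpha> is removed from its own
      twins, whence \<open>\<mu> - 1\<close>.\<close>
    have "{\<beta> \<in> V. \<alpha> \<noteq> \<beta> \<and> concurrence n S \<alpha> \<beta> = n} = {\<beta> \<in> V. concurrence n S \<alpha> \<beta> = n} - {\<alpha>}"
      by auto
    then show ?thesis using that concurrence_self card_concurrence_n by simp
  qed
  then show ?thesis by (simp add: two_eta card_V)
qed

lemma eta_eq_0:
  assumes "i \<notin> {0, 1, n}"
  shows "eta n V S i = 0"
proof -
  have "{\<beta> \<in> V. \<alpha> \<noteq> \<beta> \<and> concurrence n S \<alpha> \<beta> = i} = {}" if "\<alpha> \<in> V" for \<alpha>
    using that concurrence_cases assms by blast
  then have "2 * eta n V S i = 0" by (simp add: two_eta)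
  then show ?thesis by simp
qed

lemma real_eta_vec:
  "map real (eta_vec n V S) =
    [real n * (real k)\<^sup>2 / 2, (real n)\<^sup>2 * real k * (real k - real \<mu>) / 2]
    @ replicate (n - 2) 0 @ [real n * real k * (real \<mu> - 1) / 2]"
proof -
  have "2 * eta n V S 0 = n * k\<^sup>2" using two_eta_0_eq_iff concurrence_cases by blast
  then have e0: "real (eta n V S 0) = real n * (real k)\<^sup>2 / 2"
    by (simp add: field_simps flip: of_nat_mult of_nat_power)
  \<comment> \<open>The bound \<mu> \<le> k turns the truncated difference \<open>k - \<mu>\<close>
    into the real one.\<close>
  have "1 * \<mu> \<le> k" unfolding k_eq using n_gt_2 by (intro mult_le_mono1) simp
  moreover have "real (2 * eta n V S 1) = real (n * k * (n * (k - \<mu>)))"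
    using two_eta_1 by simp
  ultimately have e1: "real (eta n V S 1) = (real n)\<^sup>2 * real k * (real k - real \<mu>) / 2"
    by (simp add: of_nat_diff power2_eq_square mult_ac)
  have "real (2 * eta n V S n) = real (n * k * (\<mu> - 1))" using two_eta_n by simp
  then have en: "real (eta n V S n) = real n * real k * (real \<mu> - 1) / 2"
    using mu_pos by (simp add: of_nat_diff)
  have "[0..<n + 1] = [0, 1] @ [2..<n] @ [n]"
    using n_gt_2 upt_conv_Cons[of 0 n] upt_conv_Cons[of 1 n] by (simp add: numeral_2_eq_2)
  moreover have "map (\<lambda>i. real (eta n V S i)) [2..<n] = replicate (n - 2) 0"
    by (rule nth_equalityI) (auto simp: eta_eq_0)
  ultimately show ?thesis
    using e0 e1 en by (simp add: eta_vec_def comp_def)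
qed

section \<open>Twins inside blocks\<close>

lemma twins_subset_block:
  assumes "i < n" "j < n" "\<alpha> \<in> S i j"
  shows "{\<beta> \<in> V. concurrence n S \<alpha> \<beta> = n} \<subseteq> S i j"
proof
  fix \<beta> assume "\<beta> \<in> {\<beta> \<in> V. concurrence n S \<alpha> \<beta> = n}"
  then have "cells n S \<alpha> = cells n S \<beta>"
    using assms block_subset concurrence_eq_n_iff by blast
  then show "\<beta> \<in> S i j" using assms by (auto simp: cells_def set_eq_iff)
qed

lemma concurrence_ge_1:
  assumes "i < n" "j < n" "\<alpha> \<in> S i j" "\<beta> \<in> S i j"
  shows "concurrence n S \<alpha> \<beta> \<noteq> 0"
proof -
  have "(i, j) \<in> cells n S \<alpha> \<inter> cells n S \<beta>" using assms by (auto simp: cells_def)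
  then show ?thesis by (auto simp: concurrence_eq_card_Int)
qed

text \<open>For \<alpha> in the block these are its twins. Otherwise the block contains no twin of
  \<alpha>, so the concurrences are 0 or 1 and their sum counts the ones:
  \<open>(n - 2) * \<mu>\<close> out of \<open>(n - 1) * \<mu>\<close> treatments.\<close>

lemma card_block_concurrence_ne_1:
  assumes "\<alpha> \<in> V" and ij: "i < n" "j < n"
  shows "card {\<beta> \<in> S i j. concurrence n S \<alpha> \<beta> \<noteq> 1} = \<mu>"
proof (cases "\<alpha> \<in> S i j")
  case True
  have "{\<beta> \<in> S i j. concurrence n S \<alpha> \<beta> \<noteq> 1} = {\<beta> \<in> V. concurrence n S \<alpha> \<beta> = n}"
    using twins_subset_block[OF ij True] concurrence_ge_1[OF ij True]
      concurrence_cases[OF assms(1)] block_subset[OF ij] n_gt_2 by fastforce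
  then show ?thesis using card_concurrence_n assms by simp
next
  case False
  have pt: "concurrence n S \<alpha> \<beta> = (if concurrence n S \<alpha> \<beta> = 1 then 1 else 0)" if "\<beta> \<in> S i j" for \<beta>
  proof -
    have "\<beta> \<in> V" using that block_subset ij by blast
    moreover have "concurrence n S \<alpha> \<beta> \<noteq> n"
      using False assms(1) twins_subset_block[OF ij that] concurrence_sym[of n S \<alpha> \<beta>] by auto
    ultimately show ?thesis using concurrence_cases[OF assms(1)] by auto
  qed
  have "(n - 2) * \<mu> = (\<Sum>\<beta>\<in>S i j. if concurrence n S \<alpha> \<beta> = 1 then 1 else 0)"
    unfolding sum_concurrence_block_not_mem[OF ij assms(1) False, symmetric]
    using pt by (rule sum.cong[OF refl])
  also have "\<dots> = card {\<beta> \<in> S i j. concurrence n S \<alpha> \<beta> = 1}"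
    using finite_block[OF ij] by (simp add: sum.If_cases Int_def)
  finally have 1: "card {\<beta> \<in> S i j. concurrence n S \<alpha> \<beta> = 1} = (n - 2) * \<mu>" by simp
  have "{\<beta> \<in> S i j. concurrence n S \<alpha> \<beta> \<noteq> 1} = S i j - {\<beta> \<in> S i j. concurrence n S \<alpha> \<beta> = 1}"
    by auto
  then have "card {\<beta> \<in> S i j. concurrence n S \<alpha> \<beta> \<noteq> 1} = (n - 1) * \<mu> - (n - 2) * \<mu>"
    using 1 finite_block[OF ij] card_block[OF ij] k_eq by (simp add: card_Diff_subset)
  also have "\<dots> = \<mu>" using n_gt_2 by (simp flip: diff_mult_distrib)
  finally show ?thesis .
qed

lemma concurrence_eq_n_cong:
  "\<alpha> \<in> V \<Longrightarrow> \<beta> \<in> V \<Longrightarrow> concurrence n S \<alpha> \<beta> = n \<Longrightarrow> concurrence n S \<gamma> \<alpha> = concurrence n S \<gamma> \<beta>"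
  using concurrence_eq_n_iff by (simp add: concurrence_eq_card_Int)

text \<open>Twins of \<beta> lie in the same block and have the same concurrence with \<alpha>,
  which gives one inclusion; both sets have \<mu> elements.\<close>

lemma twins_eq_block:
  assumes ij: "i < n" "j < n" and "\<alpha> \<in> V" "\<beta> \<in> S i j" "concurrence n S \<alpha> \<beta> \<noteq> 1"
  shows "{\<gamma> \<in> S i j. concurrence n S \<alpha> \<gamma> \<noteq> 1} = {\<gamma> \<in> V. concurrence n S \<beta> \<gamma> = n}"
proof -
  have V: "\<beta> \<in> V" using assms block_subset by blast
  have "{\<gamma> \<in> V. concurrence n S \<beta> \<gamma> = n} \<subseteq> {\<gamma> \<in> S i j. concurrence n S \<alpha> \<gamma> \<noteq> 1}"
  proof
    fix \<gamma> assume "\<gamma> \<in> {\<gamma> \<in> V. concurrence n S \<beta> \<gamma> = n}"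
    then show "\<gamma> \<in> {\<gamma> \<in> S i j. concurrence n S \<alpha> \<gamma> \<noteq> 1}"
      using twins_subset_block[OF ij assms(4)] concurrence_eq_n_cong[OF V, of \<gamma> \<alpha>] assms(5) by auto
  qed
  then show ?thesis
    using card_subset_eq[of "{\<gamma> \<in> S i j. concurrence n S \<alpha> \<gamma> \<noteq> 1}"] finite_block[OF ij]
      card_block_concurrence_ne_1[OF assms(3) ij] card_concurrence_n[OF V] by auto
qed

text \<open>
  By \<open>twins_eq_block\<close>, two treatments not concurring once with \<open>\<alpha>\<close> that share a block are twins.
\<close>

lemma concurrence_ne_1_trans:
  assumes "\<alpha> \<in> V" "\<beta> \<in> V" "\<gamma> \<in> V" "concurrence n S \<alpha> \<beta> \<noteq> 1" "concurrence n S \<alpha> \<gamma> \<noteq> 1"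
  shows "concurrence n S \<beta> \<gamma> \<noteq> 1"
proof
  assume 1: "concurrence n S \<beta> \<gamma> = 1"
  then have "cells n S \<beta> \<inter> cells n S \<gamma> \<noteq> {}" by (auto simp: concurrence_eq_card_Int)
  then obtain i j where ij: "i < n" "j < n" "\<beta> \<in> S i j" "\<gamma> \<in> S i j" by (auto simp: cells_def)
  then have "concurrence n S \<beta> \<gamma> = n" using twins_eq_block[of i j \<alpha> \<beta>] assms by blast
  then show False using 1 n_gt_2 by simp
qed

section \<open>The equivalence classes and their Latin squares\<close>

lemma card_concurrence_ne_1:
  assumes "\<alpha> \<in> V"
  shows "card {\<beta> \<in> V. concurrence n S \<alpha> \<beta> \<noteq> 1} = n * \<mu>"
proof -
  have "{\<beta> \<in> V. concurrence n S \<alpha> \<beta> \<noteq> 1}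
    = {\<beta> \<in> V. concurrence n S \<alpha> \<beta> = 0} \<union> {\<beta> \<in> V. concurrence n S \<alpha> \<beta> = n}"
    using concurrence_cases[OF assms] n_gt_2 by auto
  moreover have "card {\<beta> \<in> V. concurrence n S \<alpha> \<beta> = 0} = k"
    using card_concurrence_0_eq_iff concurrence_cases assms by blast
  moreover have "{\<beta> \<in> V. concurrence n S \<alpha> \<beta> = 0} \<inter> {\<beta> \<in> V. concurrence n S \<alpha> \<beta> = n} = {}"
    using n_gt_2 by auto
  ultimately have "card {\<beta> \<in> V. concurrence n S \<alpha> \<beta> \<noteq> 1} = k + \<mu>"
    using card_concurrence_n[OF assms] by (simp add: card_Un_disjoint)
  also have "\<dots> = n * \<mu>" using n_gt_2 by (simp add: k_eq diff_mult_distrib)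
  finally show ?thesis .
qed

text \<open>A class has \<open>k\<close> treatments avoiding \<alpha> and \<mu> twins of \<alpha>,
  so \<open>k + \<mu> = n * \<mu>\<close> elements, and the \<open>n * k\<close> treatments form
  \<open>n - 1\<close> classes. They are numbered because they will index the Latin squares.\<close>

lemma obtain_classes:
  obtains E :: "nat \<Rightarrow> 'a set"
  where "(\<Union>t<n - 1. E t) = V" "disjoint_family_on E {..<n - 1}"
    "\<And>t. t < n - 1 \<Longrightarrow> E t \<noteq> {}"
    "\<And>t \<alpha>. t < n - 1 \<Longrightarrow> \<alpha> \<in> E t \<Longrightarrow> E t = {\<beta> \<in> V. concurrence n S \<alpha> \<beta> \<noteq> 1}"
proof -
  define R where "R = {(\<alpha>, \<beta>). \<alpha> \<in> V \<and> \<beta> \<in> V \<and> concurrence n S \<alpha> \<beta> \<noteq> 1}"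
  have R: "equiv V R"
  proof (rule equivI)
    show "R \<subseteq> V \<times> V" by (auto simp: R_def)
    show "refl_on V R" using concurrence_self n_gt_2 by (auto simp: R_def refl_on_def)
    show "sym R" by (auto simp: R_def concurrence_sym intro!: symI)
    show "trans R"
    proof (rule transI)
      fix x y z assume "(x, y) \<in> R" "(y, z) \<in> R"
      then show "(x, z) \<in> R"
        using concurrence_ne_1_trans[of y x z] by (simp add: R_def concurrence_sym[of n S x y])
    qed
  qed
  have cls: "R `` {\<alpha>} = {\<beta> \<in> V. concurrence n S \<alpha> \<beta> \<noteq> 1}" if "\<alpha> \<in> V" for \<alpha>
    using that by (auto simp: R_def)
  have fin: "finite (V // R)" using finite_quotient[OF _ equiv_type[OF R]] by simp
  have "n * \<mu> * card (V // R) = card (\<Union>(V // R))"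
  proof (rule card_partition[OF fin])
    show "finite (\<Union>(V // R))" using Union_quotient[OF R] by simp
    show "card c = n * \<mu>" if "c \<in> V // R" for c
      using that card_concurrence_ne_1 by (auto elim!: quotientE simp: cls)
    show "c1 \<inter> c2 = {}" if "c1 \<in> V // R" "c2 \<in> V // R" "c1 \<noteq> c2" for c1 c2
      using that quotient_disj[OF R] by blast
  qed
  also have "\<dots> = n * \<mu> * (n - 1)"
    using Union_quotient[OF R] by (simp add: card_V k_eq)
  finally have card: "card (V // R) = n - 1" using n_gt_2 mu_pos by simp
  obtain E where E: "bij_betw E {0..<n - 1} (V // R)"
    using ex_bij_betw_nat_finite[OF fin] card by auto
  have mem: "E t \<in> V // R" if "t < n - 1" for t using that E by (auto simp: bij_betw_def)
  show thesis
  proof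
    have "E ` {..<n - 1} = V // R" using E by (auto simp: bij_betw_def atLeast0LessThan)
    then show "(\<Union>t<n - 1. E t) = V" using Union_quotient[OF R] by simp
    show "disjoint_family_on E {..<n - 1}"
      unfolding disjoint_family_on_def
    proof (intro ballI impI)
      fix t u assume tu: "t \<in> {..<n - 1}" "u \<in> {..<n - 1}" "t \<noteq> u"
      then have "E t \<noteq> E u" using E by (auto simp: bij_betw_def inj_on_def)
      then show "E t \<inter> E u = {}" using quotient_disj[OF R mem mem, of t u] tu by auto
    qed
    show "E t \<noteq> {}" if "t < n - 1" for t
      using mem[OF that] R equiv_class_self by (fastforce elim!: quotientE)
    show "E t = {\<beta> \<in> V. concurrence n S \<alpha> \<beta> \<noteq> 1}" if t: "t < n - 1" "\<alpha> \<in> E t" for t \<alpha>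
    proof -
      obtain x where x: "x \<in> V" "E t = R `` {x}" using mem[OF t(1)] by (auto elim: quotientE)
      then have "(x, \<alpha>) \<in> R" using t by auto
      then have "E t = R `` {\<alpha>}" using x equiv_class_eq[OF R] by metis
      moreover have "\<alpha> \<in> V" using \<open>(x, \<alpha>) \<in> R\<close> by (simp add: R_def)
      ultimately show ?thesis using cls by simp
    qed
  qed
qed

text \<open>Twin classes become symbols, and each \<open>E t\<close> the symbols of one square. A
  block meets \<open>E t\<close> in a single twin class, so the cells of that square are singletons;
  treatments from different \<open>E t\<close> concur once, which is orthogonality.\<close>

lemma inflation_of_MOLS: "inflation_of_MOLS_superposition n \<mu> (n - 1) V S"
proof -
  obtain E :: "nat \<Rightarrow> 'a set" where E_Un: "(\<Union>t<n - 1. E t) = V"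
    and E_disj: "disjoint_family_on E {..<n - 1}"
    and E_ne: "\<And>t. t < n - 1 \<Longrightarrow> E t \<noteq> {}"
    and E_eq: "\<And>t \<alpha>. t < n - 1 \<Longrightarrow> \<alpha> \<in> E t \<Longrightarrow> E t = {\<beta> \<in> V. concurrence n S \<alpha> \<beta> \<noteq> 1}"
    by (rule obtain_classes) (rule that)
  have E_sub: "E t \<subseteq> V" if "t < n - 1" for t using that E_Un by blast
  \<comment> \<open>Symbols have to be natural numbers, so the cell set that identifies a twin class
    is named by a number.\<close>
  obtain g :: "(nat \<times> nat) set \<Rightarrow> nat" where g: "inj_on g (cells n S ` V)"
    using finite_imp_inj_to_nat_seg[of "cells n S ` V"] by auto
  define f where "f \<alpha> = g (cells n S \<alpha>)" for \<alpha>
  have f_eq: "f \<beta> = f \<alpha> \<longleftrightarrow> concurrence n S \<alpha> \<beta> = n" if "\<alpha> \<in> V" "\<beta> \<in> V" for \<alpha> \<beta>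
    using that g concurrence_eq_n_iff[OF that] by (auto simp: f_def inj_on_def)
  have fibre: "card {\<beta> \<in> V. f \<beta> = f \<alpha>} = \<mu>" if "\<alpha> \<in> V" for \<alpha>
  proof -
    have "{\<beta> \<in> V. f \<beta> = f \<alpha>} = {\<beta> \<in> V. concurrence n S \<alpha> \<beta> = n}"
      using f_eq that by auto
    then show ?thesis using card_concurrence_n that by simp
  qed
  have f_block: "\<beta> \<in> S i j" if "i < n" "j < n" "\<alpha> \<in> S i j" "\<beta> \<in> V" "f \<beta> = f \<alpha>" for \<alpha> \<beta> i j
    using that twins_subset_block[of i j \<alpha>] f_eq[of \<alpha> \<beta>] block_subset[of i j] by auto
  have f_E: "\<beta> \<in> E t" if "t < n - 1" "\<alpha> \<in> E t" "\<beta> \<in> V" "f \<beta> = f \<alpha>" for \<alpha> \<beta> t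
    using that E_eq[of t \<alpha>] f_eq[of \<alpha> \<beta>] E_sub[of t] n_gt_2 by auto
  define A where "A t = f ` E t" for t
  define L where "L t i j = f ` (S i j \<inter> E t)" for t i j
  have A_iff: "f \<alpha> \<in> A t \<longleftrightarrow> \<alpha> \<in> E t" if "\<alpha> \<in> V" "t < n - 1" for \<alpha> t
    using that f_E by (auto simp: A_def)
  have L_iff: "f \<alpha> \<in> L t i j \<longleftrightarrow> \<alpha> \<in> S i j \<and> \<alpha> \<in> E t" if "\<alpha> \<in> V" "t < n - 1" "i < n" "j < n"
    for \<alpha> t i j
    using that f_E f_block by (fastforce simp: L_def)
  have card_A: "card (A t) = n" if t: "t < n - 1" for t
  proof -
    have fin: "finite (E t)" by (rule finite_subset[OF E_sub[OF t] finite_V])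
    obtain \<alpha> where \<alpha>: "\<alpha> \<in> E t" using E_ne[OF t] by blast
    \<comment> \<open>The class splits into fibres of \<open>f\<close> of size \<mu>, hence into
      \<open>n\<close> symbols.\<close>
    have "n * \<mu> = card (E t)"
      using card_concurrence_ne_1[of \<alpha>] E_sub[OF t] \<alpha> by (simp only: E_eq[OF t \<alpha>] subset_iff)
    also have "\<dots> = (\<Sum>a\<in>f ` E t. card {\<beta> \<in> E t. f \<beta> = a})"
      using sum.image_gen[OF fin, of "\<lambda>_. 1::nat" f] by simp
    also have "\<dots> = (\<Sum>a\<in>f ` E t. \<mu>)"
    proof (rule sum.cong[OF refl])
      fix a assume "a \<in> f ` E t"
      then obtain \<alpha> where a: "a = f \<alpha>" "\<alpha> \<in> E t" by blast
      have "{\<beta> \<in> E t. f \<beta> = a} = {\<beta> \<in> V. f \<beta> = f \<alpha>}"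
        using a f_E[OF t a(2)] E_sub[OF t] by auto
      then show "card {\<beta> \<in> E t. f \<beta> = a} = \<mu>" using fibre a E_sub[OF t] by auto
    qed
    finally show ?thesis using mu_pos by (simp add: A_def)
  qed
  have card_L: "card (L t i j) = 1" if t: "t < n - 1" and ij: "i < n" "j < n" for t i j
  proof -
    obtain \<alpha> where \<alpha>: "\<alpha> \<in> E t" using E_ne[OF t] by blast
    then have V: "\<alpha> \<in> V" using E_sub[OF t] by blast
    \<comment> \<open>Seen from any \<alpha> in the class, the intersection consists of the \<mu>
      treatments not concurring once with \<alpha>, which are the twins of any one of them.\<close>
    have eq: "S i j \<inter> E t = {\<gamma> \<in> S i j. concurrence n S \<alpha> \<gamma> \<noteq> 1}"
      using E_eq[OF t \<alpha>] block_subset[OF ij] by auto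
    then have "card (S i j \<inter> E t) = \<mu>" using card_block_concurrence_ne_1 V ij by simp
    then have "S i j \<inter> E t \<noteq> {}" using mu_pos by (intro notI) simp
    then obtain \<beta> where \<beta>: "\<beta> \<in> S i j" "\<beta> \<in> E t" by blast
    have "S i j \<inter> E t = {\<gamma> \<in> V. concurrence n S \<beta> \<gamma> = n}"
      unfolding eq by (rule twins_eq_block[OF ij V \<beta>(1)]) (use eq \<beta> in auto)
    also have "\<dots> = {\<gamma> \<in> V. f \<gamma> = f \<beta>}" using f_eq[of \<beta>] \<beta> E_sub[OF t] by auto
    finally have "L t i j = {f \<beta>}" using \<beta> by (auto simp: L_def)
    then show ?thesis by simp
  qed
  have latin: "latin_square n (A t) (L t)" if t: "t < n - 1" for t
  proof -
    have "\<exists>!j. j < n \<and> f \<alpha> \<in> L t i j" if "\<alpha> \<in> E t" "i < n" for \<alpha> i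
    proof -
      have "j < n \<and> f \<alpha> \<in> L t i j \<longleftrightarrow> j < n \<and> \<alpha> \<in> S i j" for j
        using that L_iff[of \<alpha> t i j] E_sub[OF t] t by auto
      then show ?thesis using ex1_col[of \<alpha> i] that E_sub[OF t] by auto
    qed
    moreover have "\<exists>!i. i < n \<and> f \<alpha> \<in> L t i j" if "\<alpha> \<in> E t" "j < n" for \<alpha> j
    proof -
      have "i < n \<and> f \<alpha> \<in> L t i j \<longleftrightarrow> i < n \<and> \<alpha> \<in> S i j" for i
        using that L_iff[of \<alpha> t i j] E_sub[OF t] t by auto
      then show ?thesis using ex1_row[of \<alpha> j] that E_sub[OF t] by auto
    qed
    moreover have "finite (A t)" using finite_subset[OF E_sub[OF t] finite_V] by (simp add: A_def)
    moreover have "L t i j \<subseteq> A t" for i j by (auto simp: L_def A_def)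
    ultimately show ?thesis
      using n_gt_2 card_A[OF t] card_L[OF t] by (auto simp: semi_latin_square_def A_def)
  qed
  have orth: "orthogonal n (A t) (L t) (A u) (L u)" if t: "t < n - 1" "u < n - 1" "t \<noteq> u" for t u
    unfolding orthogonal_def
  proof (intro ballI)
    fix x y assume "x \<in> A t" "y \<in> A u"
    then obtain \<alpha> \<beta> where x: "x = f \<alpha>" "\<alpha> \<in> E t" and y: "y = f \<beta>" "\<beta> \<in> E u"
      by (auto simp: A_def)
    have V: "\<alpha> \<in> V" "\<beta> \<in> V" using x y E_sub t by auto
    have "\<beta> \<notin> E t" using E_disj t y by (auto simp: disjoint_family_on_def)
    then have "concurrence n S \<alpha> \<beta> = 1" using E_eq[OF t(1) x(2)] V by auto
    moreover have "{(i, j). i < n \<and> j < n \<and> x \<in> L t i j \<and> y \<in> L u i j}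
      = {(i, j). i < n \<and> j < n \<and> \<alpha> \<in> S i j \<and> \<beta> \<in> S i j}"
      using x y L_iff V t by auto
    ultimately show "card {(i, j). i < n \<and> j < n \<and> x \<in> L t i j \<and> y \<in> L u i j} = 1"
      by (simp add: concurrence_def)
  qed
  have disj: "disjoint_family_on A {..<n - 1}"
    unfolding disjoint_family_on_def
  proof (intro ballI impI)
    fix t u assume tu: "t \<in> {..<n - 1}" "u \<in> {..<n - 1}" "t \<noteq> u"
    have False if "f \<alpha> \<in> A u" "\<alpha> \<in> E t" for \<alpha>
      using that tu A_iff[of \<alpha> u] E_sub[of t] E_disj by (auto simp: disjoint_family_on_def)
    then show "A t \<inter> A u = {}" by (auto simp: A_def[of t])
  qed
  \<comment> \<open>Numbering the \<mu> treatments behind each symbol provides the inflation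
    map.\<close>
  have "\<exists>h. bij_betw h {1..\<mu>} {v \<in> V. f v = a}" if "a \<in> f ` V" for a
    using that fibre ex_bij_betw_nat_finite_1[of "{v \<in> V. f v = a}"] by auto
  then obtain \<sigma> where \<sigma>: "\<And>a. a \<in> f ` V \<Longrightarrow> bij_betw (\<sigma> a) {1..\<mu>} {v \<in> V. f v = a}"
    by metis
  have \<sigma>V: "\<sigma> a p \<in> V \<and> f (\<sigma> a p) = a" if "a \<in> f ` V" "p \<in> {1..\<mu>}" for a p
    using bij_betwE[OF \<sigma>[OF that(1)]] that by auto
  have \<sigma>_ex: "\<exists>p\<in>{1..\<mu>}. v = \<sigma> (f v) p" if "v \<in> V" for v
  proof -
    have "v \<in> \<sigma> (f v) ` {1..\<mu>}"
      using \<sigma>[of "f v"] that by (auto simp: bij_betw_def)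
    then show ?thesis by auto
  qed
  have A_Un: "(\<Union>t<n - 1. A t) = f ` V" using E_Un by (auto simp: A_def)
  have L_sub: "superposition (n - 1) L i j \<subseteq> f ` V" for i j
    using E_Un by (auto simp: superposition_def L_def)
  have f_super: "f v \<in> superposition (n - 1) L i j \<longleftrightarrow> v \<in> S i j" if "v \<in> V" "i < n" "j < n" for v i j
    using that L_iff E_Un by (auto simp: superposition_def)
  have "inflation_of n \<mu> (\<Union>t<n - 1. A t) (superposition (n - 1) L) V S"
    unfolding inflation_of_def A_Un
  proof (intro exI[of _ \<sigma>] conjI ballI allI impI)
    fix a b p q assume *: "a \<in> f ` V" "b \<in> f ` V" "p \<in> {1..\<mu>}" "q \<in> {1..\<mu>}"
    show "\<sigma> a p = \<sigma> b q \<longleftrightarrow> a = b \<and> p = q"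
      using \<sigma>V[OF *(1,3)] \<sigma>V[OF *(2,4)]
        inj_on_eq_iff[OF bij_betw_imp_inj_on[OF \<sigma>[OF *(1)]] *(3,4)] by metis
  next
    show "V = {\<sigma> \<alpha> p | \<alpha> p. \<alpha> \<in> f ` V \<and> p \<in> {1..\<mu>}}"
      using \<sigma>V \<sigma>_ex by blast
  next
    fix i j assume ij: "i < n" "j < n"
    show "S i j = {\<sigma> \<alpha> p | \<alpha> p. \<alpha> \<in> superposition (n - 1) L i j \<and> p \<in> {1..\<mu>}}" (is "_ = ?R")
    proof
      show "S i j \<subseteq> ?R"
        using \<sigma>_ex f_super[OF _ ij] block_subset[OF ij] by blast
      show "?R \<subseteq> S i j"
      proof
        fix v assume "v \<in> ?R"
        then obtain a p where v: "v = \<sigma> a p" "a \<in> superposition (n - 1) L i j" "p \<in> {1..\<mu>}"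
          by blast
        then have V: "v \<in> V" and "f v = a" using \<sigma>V[of a p] L_sub by auto
        then show "v \<in> S i j" using f_super[OF V ij] v(2) by simp
      qed
    qed
  qed
  then show ?thesis
    unfolding inflation_of_MOLS_superposition_def MOLS_def using latin orth disj by blast
qed

end

section \<open>Superpositions of MOLS with disjoint symbol sets\<close>

locale MOLS_family =
  fixes n m :: nat and A :: "nat \<Rightarrow> 'a set" and L :: "nat \<Rightarrow> nat \<Rightarrow> nat \<Rightarrow> 'a set"
  assumes MOLS: "MOLS n m A L" and disjoint: "disjoint_family_on A {..<m}" and m_pos: "m > 0"
begin

lemma latin: "t < m \<Longrightarrow> latin_square n (A t) (L t)"
  using MOLS by (simp add: MOLS_def)

lemma L_subset: "t < m \<Longrightarrow> i < n \<Longrightarrow> j < n \<Longrightarrow> L t i j \<subseteq> A t"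
  using latin by (simp add: semi_latin_square_def)

lemma index_unique: "t < m \<Longrightarrow> u < m \<Longrightarrow> \<alpha> \<in> A t \<Longrightarrow> \<alpha> \<in> A u \<Longrightarrow> t = u"
  using disjoint unfolding disjoint_family_on_def by blast

lemma superposition_iff:
  assumes "t < m" "\<alpha> \<in> A t" "i < n" "j < n"
  shows "\<alpha> \<in> superposition m L i j \<longleftrightarrow> \<alpha> \<in> L t i j"
  using assms index_unique L_subset unfolding superposition_def by blast

lemma semi_latin_superposition: "semi_latin_square n m (\<Union>t<m. A t) (superposition m L)"
proof -
  have fin: "finite (A t)" "card (A t) = n" if "t < m" for t
    using latin[OF that] by (simp_all add: semi_latin_square_def)
  have "n > 2" using latin[OF m_pos] by (simp add: semi_latin_square_def)
  moreover have "card (\<Union>t<m. A t) = n * m"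
    using fin disjoint by (subst card_UN_disjoint') auto
  moreover have "card (superposition m L i j) = m" if ij: "i < n" "j < n" for i j
  proof -
    have one: "card (L t i j) = 1" if "t < m" for t
      using latin[OF that] ij by (simp add: semi_latin_square_def)
    have "disjoint_family_on (\<lambda>t. L t i j) {..<m}"
      using disjoint L_subset ij unfolding disjoint_family_on_def by blast
    moreover have "finite (L t i j)" if "t < m" for t
      using one[OF that] card_ge_0_finite by force
    ultimately have "card (\<Union>t<m. L t i j) = (\<Sum>t<m. card (L t i j))"
      by (intro card_UN_disjoint') auto
    then show ?thesis using one by (simp add: superposition_def)
  qed
  moreover have "superposition m L i j \<subseteq> (\<Union>t<m. A t)" if "i < n" "j < n" for i j
    using that L_subset by (fastforce simp: superposition_def)
  moreover have "\<exists>!j. j < n \<and> \<alpha> \<in> superposition m L i j" if "t < m" "\<alpha> \<in> A t" "i < n" for t \<alpha> i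
  proof -
    have "j < n \<and> \<alpha> \<in> superposition m L i j \<longleftrightarrow> j < n \<and> \<alpha> \<in> L t i j" for j
      using superposition_iff that by blast
    then show ?thesis using latin[OF that(1)] that by (simp add: semi_latin_square_def)
  qed
  moreover have "\<exists>!i. i < n \<and> \<alpha> \<in> superposition m L i j" if "t < m" "\<alpha> \<in> A t" "j < n" for t \<alpha> j
  proof -
    have "i < n \<and> \<alpha> \<in> superposition m L i j \<longleftrightarrow> i < n \<and> \<alpha> \<in> L t i j" for i
      using superposition_iff that by blast
    then show ?thesis using latin[OF that(1)] that by (simp add: semi_latin_square_def)
  qed
  ultimately show ?thesis
    using m_pos fin by (auto simp: semi_latin_square_def)
qed

sublocale semi_latin n m "\<Union>t<m. A t" "superposition m L"
  by unfold_locales (rule semi_latin_superposition)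

text \<open>Distinct symbols of one square never share a cell, as its cells are singletons; for
  symbols of different squares, orthogonality gives exactly one common cell.\<close>

lemma concurrence_superposition:
  assumes "t < m" "u < m" "\<alpha> \<in> A t" "\<beta> \<in> A u"
  shows "concurrence n (superposition m L) \<alpha> \<beta> = (if \<alpha> = \<beta> then n else if t = u then 0 else 1)"
proof -
  have eq: "{(i, j). i < n \<and> j < n \<and> \<alpha> \<in> superposition m L i j \<and> \<beta> \<in> superposition m L i j}
    = {(i, j). i < n \<and> j < n \<and> \<alpha> \<in> L t i j \<and> \<beta> \<in> L u i j}"
    using superposition_iff assms by auto
  consider "\<alpha> = \<beta>" | "\<alpha> \<noteq> \<beta>" "t = u" | "\<alpha> \<noteq> \<beta>" "t \<noteq> u" by blast
  then show ?thesis
  proof cases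
    case 1
    then show ?thesis using concurrence_self assms by auto
  next
    case 2
    have "\<not> (\<alpha> \<in> L t i j \<and> \<beta> \<in> L t i j)" if "i < n" "j < n" for i j
    proof -
      have "card (L t i j) = 1" using latin[OF assms(1)] that by (simp add: semi_latin_square_def)
      then show ?thesis using 2 by (auto simp: card_1_singleton_iff)
    qed
    then have "{(i, j). i < n \<and> j < n \<and> \<alpha> \<in> L t i j \<and> \<beta> \<in> L u i j} = {}" using 2 by auto
    then have "concurrence n (superposition m L) \<alpha> \<beta> = card ({} :: (nat \<times> nat) set)"
      unfolding concurrence_def eq by (rule arg_cong)
    then show ?thesis using 2 by simp
  next
    case 3
    then have "orthogonal n (A t) (L t) (A u) (L u)" using MOLS assms by (simp add: MOLS_def)
    then show ?thesis using 3 assms unfolding concurrence_def eq by (simp add: orthogonal_def)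
  qed
qed

text \<open>
  Distinct blocks meet in at most one treatment. If \<open>m = n - 1\<close>, a block \<open>B\<close> has \<open>(n - 1)\<^sup>2\<close>
  incidences with the \<open>(n - 1)\<^sup>2\<close> blocks outside its row and column, so it meets each of them.
\<close>

lemma uniform_superposition:
  assumes m: "m = n - 1"
  shows "uniform_with n m (\<Union>t<m. A t) (superposition m L) 1"
proof -
  let ?P = "superposition m L"
  \<comment> \<open>Distinct rows suffice for this bound, and all cells of \<open>?N\<close> below
    satisfy that.\<close>
  have le1: "card (?P i j \<inter> ?P i' j') \<le> 1"
    if ij: "i < n" "j < n" "i' < n" "j' < n" "i \<noteq> i'" for i j i' j'
  proof -
    have "\<alpha> = \<beta>" if ab: "\<alpha> \<in> ?P i j \<inter> ?P i' j'" "\<beta> \<in> ?P i j \<inter> ?P i' j'" for \<alpha> \<beta>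
    proof (rule ccontr)
      assume "\<alpha> \<noteq> \<beta>"
      moreover have "\<alpha> \<in> (\<Union>t<m. A t)" "\<beta> \<in> (\<Union>t<m. A t)"
        using block_subset[OF ij(1,2)] ab by blast+
      ultimately have "concurrence n ?P \<alpha> \<beta> \<le> 1" using concurrence_superposition by auto
      moreover have "{(i, j), (i', j')} \<subseteq> cells n ?P \<alpha> \<inter> cells n ?P \<beta>"
        using ij ab by (auto simp: cells_def)
      then have "card {(i, j), (i', j')} \<le> concurrence n ?P \<alpha> \<beta>"
        unfolding concurrence_eq_card_Int by (intro card_mono) auto
      ultimately show False using ij by simp
    qed
    then show ?thesis using finite_block[OF ij(1,2)] by (simp add: card_le_Suc0_iff_eq)
  qed
  have "card (?P i j \<inter> ?P i' j') = 1"
    if ij: "i < n" "j < n" "i' < n" "j' < n" "i \<noteq> i'" "j \<noteq> j'" for i j i' j'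
  proof -
    let ?N = "({..<n} - {i}) \<times> ({..<n} - {j})"
    have fin: "finite ?N" by simp
    have N: "?N \<subseteq> {..<n} \<times> {..<n}" by auto
    have "(\<Sum>(a, b)\<in>?N. card (?P i j \<inter> ?P a b)) = (\<Sum>\<alpha>\<in>?P i j. card (?N \<inter> cells n ?P \<alpha>))"
      using sum_times_card_cells[OF finite_block[OF ij(1,2)], of ?N n "\<lambda>_. 1" ?P] N by simp
    also have "\<dots> = (\<Sum>\<alpha>\<in>?P i j. n - 1)"
    proof (rule sum.cong[OF refl])
      fix \<alpha> assume \<alpha>: "\<alpha> \<in> ?P i j"
      then have c: "(i, j) \<in> cells n ?P \<alpha>" using ij by (auto simp: cells_def)
      have "?N \<inter> cells n ?P \<alpha> = cells n ?P \<alpha> - {(i, j)}"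
        using cells_apart[OF c] cells_subset[of n ?P \<alpha>] by auto
      then show "card (?N \<inter> cells n ?P \<alpha>) = n - 1"
        using c card_cells[OF subsetD[OF block_subset[OF ij(1,2)] \<alpha>]] by simp
    qed
    \<comment> \<open>The block has \<open>n - 1\<close> treatments, so both sides equal the size of
      \<open>?N\<close>. Summands of at most 1 then have no room to fall short.\<close>
    also have "\<dots> = (\<Sum>(a, b)\<in>?N. 1)"
      using card_block[OF ij(1,2)] ij m by (simp add: split_def card_cartesian_product)
    finally have "(\<Sum>(a, b)\<in>?N. card (?P i j \<inter> ?P a b)) = (\<Sum>(a, b)\<in>?N. 1)" .
    then have "(case (i', j') of (a, b) \<Rightarrow> card (?P i j \<inter> ?P a b)) = (case (i', j') of (a, b) \<Rightarrow> 1)"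
      by (rule sum_mono_inv) (use le1 ij fin in auto)
    then show ?thesis by simp
  qed
  then show ?thesis using semi_latin_superposition by (simp add: uniform_with_def)
qed

end

section \<open>Inflations\<close>

locale inflation =
  fixes n s :: nat and W :: "'b set" and T :: "nat \<Rightarrow> nat \<Rightarrow> 'b set"
    and V :: "'a set" and S :: "nat \<Rightarrow> nat \<Rightarrow> 'a set" and \<sigma> :: "'b \<Rightarrow> nat \<Rightarrow> 'a"
  assumes \<sigma>_eq_iff: "\<And>\<alpha> \<beta> p q. \<alpha> \<in> W \<Longrightarrow> \<beta> \<in> W \<Longrightarrow> p \<in> {1..s} \<Longrightarrow> q \<in> {1..s}
      \<Longrightarrow> \<sigma> \<alpha> p = \<sigma> \<beta> q \<longleftrightarrow> \<alpha> = \<beta> \<and> p = q"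
    and V_eq: "V = {\<sigma> \<alpha> p | \<alpha> p. \<alpha> \<in> W \<and> p \<in> {1..s}}"
    and S_eq: "\<And>i j. i < n \<Longrightarrow> j < n \<Longrightarrow> S i j = {\<sigma> \<alpha> p | \<alpha> p. \<alpha> \<in> T i j \<and> p \<in> {1..s}}"
    and T_subset: "\<And>i j. i < n \<Longrightarrow> j < n \<Longrightarrow> T i j \<subseteq> W"
    and s_pos: "s > 0"
begin

lemma inflate_eq_image:
  "{\<sigma> \<alpha> p | \<alpha> p. \<alpha> \<in> B \<and> p \<in> {1..s}} = (\<lambda>(\<alpha>, p). \<sigma> \<alpha> p) ` (B \<times> {1..s})"
  by auto blast

lemma card_inflate:
  assumes "B \<subseteq> W"
  shows "card {\<sigma> \<alpha> p | \<alpha> p. \<alpha> \<in> B \<and> p \<in> {1..s}} = s * card B"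
proof -
  have "inj_on (\<lambda>(\<alpha>, p). \<sigma> \<alpha> p) (B \<times> {1..s})"
    using assms \<sigma>_eq_iff by (auto simp: inj_on_def subset_iff)
  then show ?thesis
    unfolding inflate_eq_image by (simp add: card_image card_cartesian_product mult.commute)
qed

text \<open>One direction has to undo \<open>\<sigma>\<close>, which is known to be injective only
  for treatments in \<open>W\<close> and indices in \<open>{1..s}\<close>; hence the assumption that
  the blocks of \<open>T\<close> lie in \<open>W\<close>.\<close>

lemma S_iff:
  assumes "\<alpha> \<in> W" "p \<in> {1..s}" "i < n" "j < n"
  shows "\<sigma> \<alpha> p \<in> S i j \<longleftrightarrow> \<alpha> \<in> T i j"
  using assms \<sigma>_eq_iff T_subset[OF assms(3,4)] unfolding S_eq[OF assms(3,4)] by blast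

lemma card_S: "i < n \<Longrightarrow> j < n \<Longrightarrow> card (S i j) = s * card (T i j)"
  by (simp only: S_eq card_inflate T_subset)

text \<open>Copies of distinct treatments never coincide, so inflating commutes with
  intersecting.\<close>

lemma card_S_Int:
  assumes "i < n" "j < n" "i' < n" "j' < n"
  shows "card (S i j \<inter> S i' j') = s * card (T i j \<inter> T i' j')"
proof -
  have "S i j \<inter> S i' j' = {\<sigma> \<alpha> p | \<alpha> p. \<alpha> \<in> T i j \<inter> T i' j' \<and> p \<in> {1..s}}"
  proof (intro set_eqI iffI)
    fix x assume x: "x \<in> S i j \<inter> S i' j'"
    then obtain \<alpha> p where "x = \<sigma> \<alpha> p" "\<alpha> \<in> T i j" "p \<in> {1..s}"
      unfolding S_eq[OF assms(1,2)] by blast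
    then show "x \<in> {\<sigma> \<alpha> p | \<alpha> p. \<alpha> \<in> T i j \<inter> T i' j' \<and> p \<in> {1..s}}"
      using x S_iff[OF _ _ assms(3,4), of \<alpha> p] T_subset[OF assms(1,2)] by blast
  qed (auto simp: S_eq assms)
  then show ?thesis using card_inflate[of "T i j \<inter> T i' j'"] T_subset[OF assms(1,2)] by auto
qed

text \<open>A copy of \<alpha> occupies exactly the cells of \<alpha>. In particular, two copies of
  one treatment concur as often as it does with itself.\<close>

lemma concurrence_inflation:
  assumes "\<alpha> \<in> W" "\<beta> \<in> W" "p \<in> {1..s}" "q \<in> {1..s}"
  shows "concurrence n S (\<sigma> \<alpha> p) (\<sigma> \<beta> q) = concurrence n T \<alpha> \<beta>"
  unfolding concurrence_def using S_iff assms by (intro arg_cong[of _ _ card]) auto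

lemma semi_latin_inflation:
  assumes T: "semi_latin_square n k W T"
  shows "semi_latin_square n (s * k) V S"
proof -
  interpret T: semi_latin n k W T using T by unfold_locales
  have "finite V" unfolding V_eq inflate_eq_image
    by (intro finite_imageI finite_cartesian_product T.finite_V finite_atLeastAtMost)
  moreover have "card V = n * (s * k)"
    using card_inflate[of W] T.card_V by (simp add: V_eq)
  moreover have "S i j \<subseteq> V" if "i < n" "j < n" for i j
    using T_subset[OF that] unfolding S_eq[OF that] V_eq by blast
  moreover have "\<exists>!j. j < n \<and> v \<in> S i j" if "v \<in> V" "i < n" for v i
  proof -
    obtain \<alpha> p where v: "v = \<sigma> \<alpha> p" "\<alpha> \<in> W" "p \<in> {1..s}" using \<open>v \<in> V\<close> unfolding V_eq by blast
    have "j < n \<and> v \<in> S i j \<longleftrightarrow> j < n \<and> \<alpha> \<in> T i j" for j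
      using S_iff[OF v(2,3) \<open>i < n\<close>] v(1) by blast
    then show ?thesis using T.ex1_col v(2) \<open>i < n\<close> by simp
  qed
  moreover have "\<exists>!i. i < n \<and> v \<in> S i j" if "v \<in> V" "j < n" for v j
  proof -
    obtain \<alpha> p where v: "v = \<sigma> \<alpha> p" "\<alpha> \<in> W" "p \<in> {1..s}" using \<open>v \<in> V\<close> unfolding V_eq by blast
    have "i < n \<and> v \<in> S i j \<longleftrightarrow> i < n \<and> \<alpha> \<in> T i j" for i
      using S_iff[OF v(2,3) _ \<open>j < n\<close>] v(1) by blast
    then show ?thesis using T.ex1_row v(2) \<open>j < n\<close> by simp
  qed
  ultimately show ?thesis
    using T.n_gt_2 T.k_pos s_pos card_S T.card_block by (simp add: semi_latin_square_def)
qed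

lemma uniform_inflation:
  assumes "uniform_with n k W T \<mu>"
  shows "uniform_with n (s * k) V S (s * \<mu>)"
  using assms semi_latin_inflation card_S_Int s_pos by (simp add: uniform_with_def)

end

text \<open>The superposition is uniform with intersection size 1, which inflation multiplies by
  \<open>s\<close>; its concurrences 0, 1 and \<open>n\<close> are inherited. Uniformity makes these
  squares admissible competitors for PV aberration.\<close>

lemma inflation_of_MOLS_superposition_props:
  assumes infl: "inflation_of_MOLS_superposition n s (n - 1) V S" and "n > 2" "s > 0"
  shows "uniform_with n (s * (n - 1)) V S s"
    and "\<forall>\<alpha>\<in>V. \<forall>\<beta>\<in>V. concurrence n S \<alpha> \<beta> \<in> {0, 1, n}"
proof -
  obtain A :: "nat \<Rightarrow> nat set" and L where MOLS: "MOLS n (n - 1) A L"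
    and disj: "disjoint_family_on A {..<n - 1}"
    and "inflation_of n s (\<Union>t<n - 1. A t) (superposition (n - 1) L) V S"
    using infl unfolding inflation_of_MOLS_superposition_def by blast
  from this(3) obtain \<sigma> where
    inj: "\<forall>\<alpha>\<in>\<Union>t<n - 1. A t. \<forall>\<beta>\<in>\<Union>t<n - 1. A t. \<forall>p\<in>{1..s}. \<forall>q\<in>{1..s}.
      \<sigma> \<alpha> p = \<sigma> \<beta> q \<longleftrightarrow> \<alpha> = \<beta> \<and> p = q"
    and V: "V = {\<sigma> \<alpha> p | \<alpha> p. \<alpha> \<in> (\<Union>t<n - 1. A t) \<and> p \<in> {1..s}}"
    and S: "\<forall>i<n. \<forall>j<n. S i j = {\<sigma> \<alpha> p | \<alpha> p. \<alpha> \<in> superposition (n - 1) L i j \<and> p \<in> {1..s}}"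
    unfolding inflation_of_def by (elim exE conjE) (rule that)
  interpret M: MOLS_family n "n - 1" A L
    using MOLS disj \<open>n > 2\<close> by unfold_locales auto
  interpret I: inflation n s "\<Union>t<n - 1. A t" "superposition (n - 1) L" V S \<sigma>
  proof
    show "\<sigma> \<alpha> p = \<sigma> \<beta> q \<longleftrightarrow> \<alpha> = \<beta> \<and> p = q"
      if "\<alpha> \<in> (\<Union>t<n - 1. A t)" "\<beta> \<in> (\<Union>t<n - 1. A t)" "p \<in> {1..s}" "q \<in> {1..s}" for \<alpha> \<beta> p q
      using inj that by blast
  qed (use V S M.block_subset \<open>s > 0\<close> in auto)
  show "uniform_with n (s * (n - 1)) V S s"
    using I.uniform_inflation[OF M.uniform_superposition] by simp
  show "\<forall>\<alpha>\<in>V. \<forall>\<beta>\<in>V. concurrence n S \<alpha> \<beta> \<in> {0, 1, n}"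
  proof (intro ballI)
    fix x y assume "x \<in> V" "y \<in> V"
    then obtain \<alpha> p \<beta> q t u where x: "x = \<sigma> \<alpha> p" "p \<in> {1..s}" "t < n - 1" "\<alpha> \<in> A t"
      and y: "y = \<sigma> \<beta> q" "q \<in> {1..s}" "u < n - 1" "\<beta> \<in> A u" unfolding V by blast
    then have "\<alpha> \<in> (\<Union>t<n - 1. A t)" "\<beta> \<in> (\<Union>t<n - 1. A t)" by blast+
    then have "concurrence n S x y = concurrence n (superposition (n - 1) L) \<alpha> \<beta>"
      unfolding x(1) y(1) using x(2) y(2) by (rule I.concurrence_inflation)
    then show "concurrence n S x y \<in> {0, 1, n}"
      using M.concurrence_superposition[OF x(3) y(3) x(4) y(4)] by simp
  qed
qed

section \<open>Inflated superpositions over a prescribed treatment set\<close>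

lemma latin_square_image:
  assumes L: "latin_square n A L" and inj: "inj h"
  shows "latin_square n (h ` A) (\<lambda>i j. h ` L i j)"
proof -
  interpret semi_latin n 1 A L using L by unfold_locales
  have "h ` L i j \<subseteq> h ` A \<and> card (h ` L i j) = 1" if "i < n" "j < n" for i j
    using card_block[OF that] block_subset[OF that] by (simp add: image_mono card_image inj_on_subset[OF inj])
  then show ?thesis
    using n_gt_2 card_V ex1_col ex1_row
    by (simp add: semi_latin_square_def card_image inj_on_subset[OF inj] inj_image_mem_iff[OF inj])
qed

text \<open>Symbol sets of MOLS may overlap, whereas a superposition wants them disjoint; each
  symbol is therefore tagged with the index of its square.\<close>

lemma MOLS_exist_disjoint:
  assumes "MOLS_exist n m"
  obtains A :: "nat \<Rightarrow> nat set" and L where "MOLS n m A L" "disjoint_family_on A {..<m}"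
proof -
  obtain A :: "nat \<Rightarrow> nat set" and L where AL: "MOLS n m A L"
    using assms by (auto simp: MOLS_exist_def)
  define h where "h t x = prod_encode (t, x)" for t x
  have h_inj: "inj (h t)" for t by (auto simp: h_def inj_def)
  have "orthogonal n (h t ` A t) (\<lambda>i j. h t ` L t i j) (h u ` A u) (\<lambda>i j. h u ` L u i j)"
    if "t < m" "u < m" "t \<noteq> u" for t u
    using AL that by (auto simp: MOLS_def orthogonal_def inj_image_mem_iff[OF h_inj])
  then have "MOLS n m (\<lambda>t. h t ` A t) (\<lambda>t i j. h t ` L t i j)"
    using AL latin_square_image[OF _ h_inj] by (simp add: MOLS_def)
  moreover have "disjoint_family_on (\<lambda>t. h t ` A t) {..<m}"
    by (auto simp: disjoint_family_on_def h_def)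
  ultimately show ?thesis by (rule that)
qed

text \<open>Minimality compares squares whose treatments have the same type, so the competitor is
  built on a given set \<open>V\<close>: any bijection from symbol-index pairs onto \<open>V\<close>
  serves as inflation map.\<close>

lemma inflation_of_MOLS_superposition_exists:
  fixes V :: "'a set"
  assumes "MOLS_exist n m" and "finite V" "card V = n * (s * m)" "m > 0"
  shows "\<exists>S. inflation_of_MOLS_superposition n s m V S"
proof -
  obtain A :: "nat \<Rightarrow> nat set" and L where AL: "MOLS n m A L" "disjoint_family_on A {..<m}"
    using MOLS_exist_disjoint[OF assms(1)] by blast
  interpret MOLS_family n m A L using AL \<open>m > 0\<close> by unfold_locales
  let ?W = "\<Union>t<m. A t"
  have "card (?W \<times> {1..s}) = card V"
    using card_V assms(3) by (simp add: card_cartesian_product mult_ac)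
  then obtain h where h: "bij_betw h (?W \<times> {1..s}) V"
    using finite_same_card_bij[of "?W \<times> {1..s}" V] finite_V \<open>finite V\<close> by auto
  define \<sigma> where "\<sigma> \<alpha> p = h (\<alpha>, p)" for \<alpha> p
  have "inflation_of n s ?W (superposition m L) V
    (\<lambda>i j. {\<sigma> \<alpha> p | \<alpha> p. \<alpha> \<in> superposition m L i j \<and> p \<in> {1..s}})"
    unfolding inflation_of_def
  proof (intro exI[of _ \<sigma>] conjI ballI allI impI refl)
    show "\<sigma> \<alpha> p = \<sigma> \<beta> q \<longleftrightarrow> \<alpha> = \<beta> \<and> p = q"
      if "\<alpha> \<in> ?W" "\<beta> \<in> ?W" "p \<in> {1..s}" "q \<in> {1..s}" for \<alpha> \<beta> p q
    proof -
      have "(\<alpha>, p) \<in> ?W \<times> {1..s}" "(\<beta>, q) \<in> ?W \<times> {1..s}" using that by blast+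
      then show ?thesis
        using inj_on_eq_iff[OF bij_betw_imp_inj_on[OF h]] by (simp add: \<sigma>_def)
    qed
    have "V = h ` (?W \<times> {1..s})" using h by (simp add: bij_betw_def)
    then show "V = {\<sigma> \<alpha> p | \<alpha> p. \<alpha> \<in> ?W \<and> p \<in> {1..s}}" unfolding \<sigma>_def by blast
  qed
  then show ?thesis unfolding inflation_of_MOLS_superposition_def using AL by blast
qed

section \<open>PV aberration and the equivalences\<close>

lemma eta_vec_Cons: "eta_vec n V S = eta n V S 0 # map (eta n V S) [1..<n + 1]"
  unfolding eta_vec_def by (subst upt_conv_Cons) simp_all

context uniform_square
begin

lemma eta_0_eq_real_iff:
  "real (eta n V S 0) = real n * (real k)\<^sup>2 / 2 \<longleftrightarrow> 2 * eta n V S 0 = n * k\<^sup>2"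
proof -
  have "2 * eta n V S 0 = n * k\<^sup>2 \<longleftrightarrow> real (2 * eta n V S 0) = real (n * k\<^sup>2)"
    by (simp only: of_nat_eq_iff)
  then show ?thesis by auto
qed

lemma extremal_square_iff: "extremal_square n k V S \<mu> \<longleftrightarrow> 2 * eta n V S 0 = n * k\<^sup>2"
  using uniform_square_axioms
  unfolding two_eta_0_eq_iff extremal_square_def extremal_square_axioms_def by blast

text \<open>Every competitor has the same \<mu>, since \<open>k = (n - 1) * \<mu>\<close>. Either
  its first entry is strictly larger, which decides the order, or it is extremal as well and its
  whole vector coincides.\<close>

lemma minimum_PV_aberration_extremal:
  assumes ext: "2 * eta n V S 0 = n * k\<^sup>2"
  shows "minimum_PV_aberration n k V S"
  unfolding minimum_PV_aberration_def
proof (intro conjI allI impI)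
  show "uniform n k V S" using uniform by (auto simp: uniform_def)
next
  fix W :: "'a set" and T
  assume "uniform n k W T"
  then obtain \<nu> where "uniform_with n k W T \<nu>" by (auto simp: uniform_def)
  then interpret T: uniform_square n k W T \<nu> by unfold_locales
  have "\<nu> = \<mu>" using k_eq T.k_eq n_gt_2 by auto
  show "\<not> smaller_PV_aberration n W T V S"
  proof (cases "2 * eta n W T 0 = n * k\<^sup>2")
    case True
    then interpret T: extremal_square n k W T \<mu>
      using T.extremal_square_iff \<open>\<nu> = \<mu>\<close> by simp
    interpret extremal_square n k V S \<mu> using extremal_square_iff ext by simp
    have "map real (eta_vec n W T) = map real (eta_vec n V S)"
      by (simp only: T.real_eta_vec real_eta_vec)
    then have "eta_vec n W T = eta_vec n V S"
      by (rule map_injective) simp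
    then show ?thesis by (simp add: smaller_PV_aberration_def lexord_irreflexive)
  next
    case False
    then have "eta n V S 0 < eta n W T 0" using T.two_eta_0_ge ext by linarith
    then show ?thesis by (simp add: smaller_PV_aberration_def eta_vec_Cons)
  qed
qed

end

theorem theorem5:
  fixes n k \<mu> :: nat and V :: "'a set" and S :: "nat \<Rightarrow> nat \<Rightarrow> 'a set"
  assumes "n > 2"
    and "uniform_with n k V S \<mu>"
  shows "real (eta n V S 0) \<ge> real n * (real k)\<^sup>2 / 2 \<and>
    (real (eta n V S 0) = real n * (real k)\<^sup>2 / 2 \<longleftrightarrow>
      map real (eta_vec n V S) =
        [real n * (real k)\<^sup>2 / 2, (real n)\<^sup>2 * real k * (real k - real \<mu>) / 2]
        @ replicate (n - 2) 0 @ [real n * real k * (real \<mu> - 1) / 2]) \<and>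
    (real (eta n V S 0) = real n * (real k)\<^sup>2 / 2 \<longleftrightarrow>
      inflation_of_MOLS_superposition n \<mu> (n - 1) V S) \<and>
    (real (eta n V S 0) = real n * (real k)\<^sup>2 / 2 \<longleftrightarrow>
      MOLS_exist n (n - 1) \<and> minimum_PV_aberration n k V S)"
proof -
  interpret uniform_square n k V S \<mu> using assms(2) by unfold_locales
  let ?ext = "2 * eta n V S 0 = n * k\<^sup>2"
  have "real (n * k\<^sup>2) \<le> real (2 * eta n V S 0)"
    using two_eta_0_ge by (simp only: of_nat_le_iff)
  then have 1: "real (eta n V S 0) \<ge> real n * (real k)\<^sup>2 / 2" by simp
  have 2: "map real (eta_vec n V S) =
        [real n * (real k)\<^sup>2 / 2, (real n)\<^sup>2 * real k * (real k - real \<mu>) / 2]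
        @ replicate (n - 2) 0 @ [real n * real k * (real \<mu> - 1) / 2] \<longleftrightarrow> ?ext" (is "?L = ?R \<longleftrightarrow> _")
  proof
    assume "?L = ?R"
    then have "hd ?L = hd ?R" by (rule arg_cong)
    then have "real (eta n V S 0) = real n * (real k)\<^sup>2 / 2" by (simp add: eta_vec_Cons)
    then show ?ext unfolding eta_0_eq_real_iff .
  next
    assume ?ext
    then show "?L = ?R" by (intro extremal_square.real_eta_vec) (simp only: extremal_square_iff)
  qed
  have 3: "?ext \<longleftrightarrow> inflation_of_MOLS_superposition n \<mu> (n - 1) V S"
    using extremal_square.inflation_of_MOLS extremal_square_iff two_eta_0_eq_iff
      inflation_of_MOLS_superposition_props(2)[OF _ assms(1) mu_pos] by blast
  \<comment> \<open>MOLS supply a competitor that attains the bound, with the right block size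
    because \<open>\<mu> * (n - 1) = k\<close>. As it is not smaller than \<open>S\<close>, the
    first entry of \<open>S\<close> cannot exceed the bound either.\<close>
  have 4: ?ext if MOLS: "MOLS_exist n (n - 1)" and min: "minimum_PV_aberration n k V S"
  proof -
    have "card V = n * (\<mu> * (n - 1))" by (simp add: card_V k_eq mult.commute)
    then obtain T where T: "inflation_of_MOLS_superposition n \<mu> (n - 1) V T"
      using inflation_of_MOLS_superposition_exists[OF MOLS finite_V] assms(1) by auto
    note props = inflation_of_MOLS_superposition_props[OF T assms(1) mu_pos]
    interpret T: uniform_square n k V T \<mu>
      using props(1) by unfold_locales (simp add: k_eq mult.commute)
    have "uniform n k V T" using T.uniform by (auto simp: uniform_def)
    then have "\<not> smaller_PV_aberration n V T V S"
      using min by (auto simp: minimum_PV_aberration_def)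
    then have "eta n V S 0 \<le> eta n V T 0"
      by (simp add: smaller_PV_aberration_def eta_vec_Cons)
    moreover have "2 * eta n V T 0 = n * k\<^sup>2" using T.two_eta_0_eq_iff props(2) by blast
    ultimately show ?ext using two_eta_0_ge by linarith
  qed
  have "MOLS_exist n (n - 1)" if ?ext
    using that 3 by (auto simp: inflation_of_MOLS_superposition_def MOLS_exist_def)
  then show ?thesis
    unfolding eta_0_eq_real_iff using 1 2 3 4 minimum_PV_aberration_extremal by blast
qed

end
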